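(* For $i=1,2$ let $G_{i}$ be an $r_{i}$-regular graph of order $p_{i}$ with adjacency spectrum $\{r_{i},\lambda_{i_{2}},\lambda_{i_{3}},\ldots,\lambda_{i_{p_{i}}}\}$. Then the distance spectrum of the subdivision-edge join $G_{1}\oplus G_{2}$ consists of: (1) $-\left(\lambda_{1_{j}}+3\pm\sqrt{(\lambda_{1_{j}}+1)^{2}+4(\lambda_{1_{j}}+r_{1})}\right)$, $j=2,\ldots,p_{1}$; (2) $-\left(\lambda_{2_{j}}+3\pm\sqrt{(\lambda_{2_{j}}+1)^{2}+4(\lambda_{2_{j}}+r_{2})}\right)$, $j=2,\ldots,p_{2}$; (3) $-2$ with multiplicity $\frac{1}{2}p_{1}r_{1}+\frac{1}{2}p_{2}r_{2}-p_{1}-p_{2}$; (4) the four eigenvalues of the matrix $$\begin{bmatrix} 4p_{1}-2r_{1}-4 & \frac{3}{2}p_{1}r_{1}-2r_{1} & 3p_{2} & p_{2}r_{2}\\ 3p_{1}-4 & p_{1}r_{1}-2 & 2p_{2} & \frac{1}{2}p_{2}r_{2}\\ 3p_{1} & p_{1}r_{1} & 4p_{2}-2r_{2}-4 & \frac{3}{2}p_{2}r_{2}-2r_{2}\\ 2p_{1} & \frac{1}{2}p_{1}r_{1} & 3p_{2}-4 & p_{2}r_{2}-2\end{bmatrix}.$$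
   Context: The subdivision graph $S(G)$ is obtained from $G$ by inserting a new vertex into every edge; $I(G)$ denotes the set of these new vertices (one per edge of $G$). The subdivision-edge join $G_1\oplus G_2$ of vertex-disjoint graphs is obtained from $S(G_1)$ and $S(G_2)$ by joining each vertex of $I(G_1)$ with every vertex of $I(G_2)$. The distance spectrum of a connected graph is the multiset of eigenvalues of its distance matrix $\mathcal{D}$ (entries are shortest-path distances). *)

theory Defs
  imports
    "Graph_Theory.Graph_Theory"
    "Jordan_Normal_Form.Char_Poly"
    "HOL-Computational_Algebra.Fundamental_Theorem_Algebra"
begin

text \<open>
  A finite simple undirected graph is a \<open>pair_graph\<close>: an irreflexive symmetric arc relation on
  a finite vertex set. An undirected edge is the pair of arcs \<open>(u, v)\<close>, \<open>(v, u)\<close>; where one object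
  per edge is needed, the edge is the set \<open>{u, v}\<close>.
\<close>

definition undirected_edges :: "'a pair_pre_digraph \<Rightarrow> 'a set set" where
  "undirected_edges G = {{u, v} | u v. (u, v) \<in> parcs G}"

definition regular_graph :: "'a pair_pre_digraph \<Rightarrow> nat \<Rightarrow> bool" where
  "regular_graph G r \<longleftrightarrow> pair_graph G \<and> (\<forall>v\<in>pverts G. out_degree (with_proj G) v = r)"


subsection \<open>Subdivision graph and subdivision-edge join\<close>

text \<open>
  In \<open>S(G)\<close> the original vertex \<open>v\<close> is \<open>Inl v\<close> and the vertex inserted into the edge \<open>e\<close>
  is \<open>Inr e\<close>.
\<close>

definition inserted_vertices :: "'a pair_pre_digraph \<Rightarrow> ('a + 'a set) set" where
  "inserted_vertices G = Inr ` undirected_edges G"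

definition subdivision_arcs :: "'a pair_pre_digraph \<Rightarrow> ('a + 'a set) rel" where
  "subdivision_arcs G = {(Inl v, Inr e) | v e. e \<in> undirected_edges G \<and> v \<in> e}"

definition subdivision_graph :: "'a pair_pre_digraph \<Rightarrow> ('a + 'a set) pair_pre_digraph" where
  "subdivision_graph G =
     \<lparr> pverts = Inl ` pverts G \<union> inserted_vertices G,
       parcs = subdivision_arcs G \<union> (subdivision_arcs G)\<inverse> \<rparr>"

text \<open>
  The outer sum type makes the two subdivision graphs vertex-disjoint, so that no disjointness
  assumption on \<open>G\<^sub>1\<close> and \<open>G\<^sub>2\<close> is needed.
\<close>

definition subdivision_edge_join ::
  "'a pair_pre_digraph \<Rightarrow> 'b pair_pre_digraph \<Rightarrow> (('a + 'a set) + ('b + 'b set)) pair_pre_digraph"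
where
  "subdivision_edge_join G\<^sub>1 G\<^sub>2 =
     (let joining = {(Inl x, Inr y) | x y. x \<in> inserted_vertices G\<^sub>1 \<and> y \<in> inserted_vertices G\<^sub>2} in
     \<lparr> pverts = Inl ` pverts (subdivision_graph G\<^sub>1) \<union> Inr ` pverts (subdivision_graph G\<^sub>2),
       parcs = map_prod Inl Inl ` parcs (subdivision_graph G\<^sub>1)
             \<union> map_prod Inr Inr ` parcs (subdivision_graph G\<^sub>2)
             \<union> joining \<union> joining\<inverse> \<rparr>)"

lemma subdivision_graph_simps:
  "pverts (subdivision_graph G) = Inl ` pverts G \<union> inserted_vertices G"
  "parcs (subdivision_graph G) = subdivision_arcs G \<union> (subdivision_arcs G)\<inverse>"
  by (simp_all add: subdivision_graph_def)

lemma finite_undirected_edges: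
  assumes "pair_graph G" shows "finite (undirected_edges G)"
proof -
  interpret pair_graph G by fact
  have "undirected_edges G = (\<lambda>(u, v). {u, v}) ` parcs G"
    by (auto simp: undirected_edges_def image_iff)
  then show ?thesis using pair_finite_arcs by simp
qed

lemma undirected_edges_subset:
  assumes "pair_graph G" "e \<in> undirected_edges G" "v \<in> e" shows "v \<in> pverts G"
proof -
  interpret pair_graph G by fact
  show ?thesis using assms(2,3) by (auto simp: undirected_edges_def dest: in_arcsD1 in_arcsD2)
qed

lemma pair_graphI:
  assumes "finite (pverts G)" "parcs G \<subseteq> pverts G \<times> pverts G"
    and "sym (parcs G)" "\<And>v. (v, v) \<notin> parcs G"
  shows "pair_graph G"
proof
  show "finite (parcs G)" using assms(1,2) by (meson finite_SigmaI finite_subset)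
  show "symmetric (with_proj G)" using assms(3) by (simp add: symmetric_def)
  show "fst e \<noteq> snd e" if "e \<in> parcs G" for e
    using that assms(4) by (cases e) auto
qed (use assms in auto)

lemma pair_graph_subdivision_graph:
  assumes "pair_graph G" shows "pair_graph (subdivision_graph G)"
proof (rule pair_graphI)
  interpret pair_graph G by fact
  show "finite (pverts (subdivision_graph G))"
    using pair_finite_verts finite_undirected_edges[OF assms]
    by (simp add: subdivision_graph_simps inserted_vertices_def)
qed (use undirected_edges_subset[OF assms] in
      \<open>auto simp: subdivision_graph_simps inserted_vertices_def subdivision_arcs_def sym_def\<close>)

lemma pair_graph_subdivision_edge_join:
  assumes "pair_graph G\<^sub>1" "pair_graph G\<^sub>2"
  shows "pair_graph (subdivision_edge_join G\<^sub>1 G\<^sub>2)"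
proof (rule pair_graphI)
  interpret S1: pair_graph "subdivision_graph G\<^sub>1"
    using assms(1) by (rule pair_graph_subdivision_graph)
  interpret S2: pair_graph "subdivision_graph G\<^sub>2"
    using assms(2) by (rule pair_graph_subdivision_graph)
  let ?J = "subdivision_edge_join G\<^sub>1 G\<^sub>2"
  show "finite (pverts ?J)"
    using S1.pair_finite_verts S2.pair_finite_verts by (simp add: subdivision_edge_join_def Let_def)
  have "parcs (subdivision_graph G\<^sub>1) \<subseteq> pverts (subdivision_graph G\<^sub>1) \<times> pverts (subdivision_graph G\<^sub>1)"
    "parcs (subdivision_graph G\<^sub>2) \<subseteq> pverts (subdivision_graph G\<^sub>2) \<times> pverts (subdivision_graph G\<^sub>2)"
    by (auto dest: S1.in_arcsD1 S1.in_arcsD2 S2.in_arcsD1 S2.in_arcsD2)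
  moreover have "inserted_vertices G\<^sub>1 \<subseteq> pverts (subdivision_graph G\<^sub>1)"
    "inserted_vertices G\<^sub>2 \<subseteq> pverts (subdivision_graph G\<^sub>2)"
    by (auto simp: subdivision_graph_simps)
  ultimately show "parcs ?J \<subseteq> pverts ?J \<times> pverts ?J"
    unfolding subdivision_edge_join_def Let_def by auto
  show "sym (parcs ?J)"
    using S1.arcs_symmetric S2.arcs_symmetric
    by (fastforce simp: subdivision_edge_join_def Let_def sym_def)
  show "(v, v) \<notin> parcs ?J" for v
    by (auto simp: subdivision_edge_join_def Let_def dest: S1.no_loops' S2.no_loops')
qed


subsection \<open>Spectra\<close>

text \<open>
  The multiset of all complex eigenvalues, counted with algebraic multiplicity; its size is the
  dimension of the matrix.
\<close>

definition eigenvalue_mset :: "real mat \<Rightarrow> complex multiset" where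
  "eigenvalue_mset A = proots (char_poly (map_mat complex_of_real A))"

definition vertex_mat :: "'a list \<Rightarrow> ('a \<Rightarrow> 'a \<Rightarrow> real) \<Rightarrow> real mat" where
  "vertex_mat xs f = mat (length xs) (length xs) (\<lambda>(i, j). f (xs ! i) (xs ! j))"

text \<open>
  The eigenvalues of a matrix whose rows and columns are indexed by a finite set. The choice of the
  enumeration is irrelevant, see lemma \<open>indexed_eigenvalues_eq\<close>.
\<close>

definition indexed_eigenvalues :: "'a set \<Rightarrow> ('a \<Rightarrow> 'a \<Rightarrow> real) \<Rightarrow> complex multiset" where
  "indexed_eigenvalues V f =
     eigenvalue_mset (vertex_mat (SOME xs. distinct xs \<and> set xs = V) f)"

lemma similar_vertex_mat:
  assumes xs: "distinct xs" "set xs = V" and ys: "distinct ys" "set ys = V"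
  shows "similar_mat (map_mat complex_of_real (vertex_mat xs f))
           (map_mat complex_of_real (vertex_mat ys f))"
proof -
  define n where "n = length xs"
  have n: "length xs = n" "length ys = n"
    using assms by (auto simp: n_def simp flip: distinct_card)
  define p where "p i = (THE j. j < n \<and> ys ! j = xs ! i)" for i
  have p: "p i < n \<and> ys ! p i = xs ! i" if "i < n" for i
    unfolding p_def
    by (rule theI') (use that xs ys n in \<open>metis distinct_Ex1 nth_mem\<close>)
  have p_iff: "xs ! i = ys ! j \<longleftrightarrow> j = p i" if "i < n" "j < n" for i j
    using that p ys n by (metis nth_eq_iff_index_eq)
  define q where "q j = (THE i. i < n \<and> xs ! i = ys ! j)" for j
  have q: "q j < n \<and> xs ! q j = ys ! j" if "j < n" for j
    unfolding q_def
    by (rule theI') (use that xs ys n in \<open>metis distinct_Ex1 nth_mem\<close>)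
  have q_iff: "xs ! i = ys ! j \<longleftrightarrow> i = q j" if "i < n" "j < n" for i j
    using that q xs n by (metis nth_eq_iff_index_eq)
  define P :: "complex mat" where "P = mat n n (\<lambda>(i, j). if xs ! i = ys ! j then 1 else 0)"
  define Q :: "complex mat" where "Q = mat n n (\<lambda>(j, i). if xs ! i = ys ! j then 1 else 0)"
  define A where "A = map_mat complex_of_real (vertex_mat xs f)"
  define B where "B = map_mat complex_of_real (vertex_mat ys f)"
  have carr: "A \<in> carrier_mat n n" "B \<in> carrier_mat n n" "P \<in> carrier_mat n n" "Q \<in> carrier_mat n n"
    by (auto simp: A_def B_def P_def Q_def vertex_mat_def n)
  have PQ: "P * Q = 1\<^sub>m n"
  proof (rule eq_matI, goal_cases)
    case (1 i j)
    then have "(P * Q) $$ (i, j) = (\<Sum>k<n. P $$ (i, k) * Q $$ (k, j))"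
      using carr by (simp add: scalar_prod_def atLeast0LessThan)
    also have "\<dots> = (\<Sum>k<n. if k = p i then if p j = p i then 1 else 0 else 0)"
      by (rule sum.cong) (use 1 p in \<open>auto simp: P_def Q_def p_iff\<close>)
    also have "\<dots> = (if p j = p i then 1 else 0)" using p 1 by simp
    also have "p j = p i \<longleftrightarrow> i = j"
      using p 1 xs n by (metis index_one_mat(2,3) nth_eq_iff_index_eq)
    finally show ?case using 1 by simp
  qed (use carr in auto)
  have QP: "Q * P = 1\<^sub>m n"
  proof (rule eq_matI, goal_cases)
    case (1 i j)
    then have "(Q * P) $$ (i, j) = (\<Sum>k<n. Q $$ (i, k) * P $$ (k, j))"
      using carr by (simp add: scalar_prod_def atLeast0LessThan)
    also have "\<dots> = (\<Sum>k<n. if k = q i then if q j = q i then 1 else 0 else 0)"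
      by (rule sum.cong) (use 1 q in \<open>auto simp: P_def Q_def q_iff\<close>)
    also have "\<dots> = (if q j = q i then 1 else 0)" using q 1 by simp
    also have "q j = q i \<longleftrightarrow> i = j"
      using q 1 ys n by (metis index_one_mat(2,3) nth_eq_iff_index_eq)
    finally show ?case using 1 by simp
  qed (use carr in auto)
  have AP: "A * P = P * B"
  proof (rule eq_matI, goal_cases)
    case (1 i j)
    then have ij: "i < n" "j < n" using carr by auto
    have "(A * P) $$ (i, j) = (\<Sum>k<n. A $$ (i, k) * P $$ (k, j))"
      using ij carr by (simp add: scalar_prod_def atLeast0LessThan)
    also have "\<dots> = (\<Sum>k<n. if k = q j then of_real (f (xs ! i) (xs ! q j)) else 0)"
      by (rule sum.cong) (use ij in \<open>auto simp: A_def P_def vertex_mat_def n q_iff\<close>)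
    also have "\<dots> = of_real (f (xs ! i) (ys ! j))" using q ij by simp
    also have "\<dots> = (\<Sum>k<n. if k = p i then of_real (f (ys ! p i) (ys ! j)) else 0)"
      using p ij by simp
    also have "\<dots> = (\<Sum>k<n. P $$ (i, k) * B $$ (k, j))"
      by (rule sum.cong) (use ij in \<open>auto simp: B_def P_def vertex_mat_def n p_iff\<close>)
    also have "\<dots> = (P * B) $$ (i, j)"
      using ij carr by (simp add: scalar_prod_def atLeast0LessThan)
    finally show ?case .
  qed (use carr in auto)
  have "A = A * (P * Q)" using PQ carr by simp
  also have "\<dots> = P * B * Q" using carr AP by (simp flip: assoc_mult_mat)
  finally have "A = P * B * Q" .
  then have "similar_mat_wit A B P Q"
    using carr PQ QP by (auto simp: similar_mat_wit_def Let_def)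
  then show ?thesis unfolding A_def B_def similar_mat_def by blast
qed

lemma indexed_eigenvalues_eq:
  assumes "distinct xs" "set xs = V"
  shows "indexed_eigenvalues V f = eigenvalue_mset (vertex_mat xs f)"
proof -
  define ys where "ys = (SOME ys. distinct ys \<and> set ys = V)"
  have "distinct ys \<and> set ys = V"
    unfolding ys_def by (rule someI[of _ xs]) (use assms in auto)
  then have "similar_mat (map_mat complex_of_real (vertex_mat ys f))
      (map_mat complex_of_real (vertex_mat xs f))"
    using assms by (intro similar_vertex_mat) auto
  then show ?thesis
    unfolding indexed_eigenvalues_def eigenvalue_mset_def ys_def[symmetric]
    by (simp add: char_poly_similar)
qed

definition adjacency_spectrum :: "'a pair_pre_digraph \<Rightarrow> complex multiset" where
  "adjacency_spectrum G = indexed_eigenvalues (pverts G) (\<lambda>u v. if (u, v) \<in> parcs G then 1 else 0)"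

text \<open>
  The shortest-path distance, i.e. the minimal number of arcs of a walk from \<open>u\<close> to \<open>v\<close>. It is
  meaningful only if there is such a walk: otherwise \<open>\<mu>\<close> is \<open>\<infinity>\<close>, which \<open>real_of_ereal\<close> sends to 0.
\<close>

definition graph_distance :: "'a pair_pre_digraph \<Rightarrow> 'a \<Rightarrow> 'a \<Rightarrow> real" where
  "graph_distance G u v = real_of_ereal (wf_digraph.\<mu> (with_proj G) (\<lambda>_. 1) u v)"

text \<open>The distance spectrum is to be used for connected graphs only.\<close>

definition distance_spectrum :: "'a pair_pre_digraph \<Rightarrow> complex multiset" where
  "distance_spectrum G = indexed_eigenvalues (pverts G) (graph_distance G)"

definition connected_graph :: "'a pair_pre_digraph \<Rightarrow> bool" where
  "connected_graph G \<longleftrightarrow> Digraph_Component.connected (with_proj G)"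

end

theory Submission
  imports Defs
begin

text \<open>
  In the join all distances are at most 4 and depend only on the types of the two vertices
  (original or inserted, first or second graph) except for adjacency, incidence and equality within
  one graph. Hence \<open>t I - D = E - U C U\<^sup>T\<close>, where \<open>U\<close> is the indicator matrix of the four vertex types
  and \<open>E\<close> is block diagonal with blocks \<open>[[(t + 4) I + 2 A, 2 B], [2 B\<^sup>T, (t + 2) I]]\<close> for the adjacency
  matrix \<open>A\<close> and the incidence matrix \<open>B\<close>. By regularity \<open>E U = U K\<close> for a 4-by-4 matrix \<open>K\<close>, so
  \<open>det (t I - D) det K = det E det (t I - M)\<close>, where \<open>M\<close> is the quotient matrix of \<open>D\<close>. Since
  \<open>B B\<^sup>T = A + r I\<close>, the determinant of each block of \<open>E\<close> is, up to powers of \<open>t + 2\<close>, the product of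
  \<open>t\<^sup>2 + (6 + 2 \<lambda>) t + 8 - 4 r\<close> over the adjacency eigenvalues \<open>\<lambda>\<close>, and the factors with \<open>\<lambda> = r\<close>
  cancel against \<open>det K\<close>.
\<close>

section \<open>Matrices indexed by lists\<close>

text \<open>Rectangular counterpart of \<open>vertex_mat\<close> with separate index lists for rows
  and columns: concatenated lists then give block matrices, and over a distinct inner list a product
  becomes a sum over the index set.\<close>

definition indexed_mat :: "'a list \<Rightarrow> 'b list \<Rightarrow> ('a \<Rightarrow> 'b \<Rightarrow> 'c) \<Rightarrow> 'c mat" where
  "indexed_mat xs ys f = mat (length xs) (length ys) (\<lambda>(i, j). f (xs ! i) (ys ! j))"

lemma indexed_mat_carrier [simp]: "indexed_mat xs ys f \<in> carrier_mat (length xs) (length ys)"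
  by (simp add: indexed_mat_def)

lemma dim_indexed_mat [simp]:
  "dim_row (indexed_mat xs ys f) = length xs" "dim_col (indexed_mat xs ys f) = length ys"
  by (simp_all add: indexed_mat_def)

lemma indexed_mat_cong:
  assumes "\<And>x y. x \<in> set xs \<Longrightarrow> y \<in> set ys \<Longrightarrow> f x y = g x y"
  shows "indexed_mat xs ys f = indexed_mat xs ys g"
  by (rule eq_matI) (auto simp: indexed_mat_def assms)

lemma indexed_mat_map: "indexed_mat (map g xs) (map h ys) f = indexed_mat xs ys (\<lambda>x y. f (g x) (h y))"
  by (rule eq_matI) (auto simp: indexed_mat_def)

lemma indexed_mat_append:
  "indexed_mat (xs @ ys) (us @ vs) f =
     four_block_mat (indexed_mat xs us f) (indexed_mat xs vs f) (indexed_mat ys us f) (indexed_mat ys vs f)"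
  by (rule eq_matI) (auto simp: indexed_mat_def nth_append)

lemma indexed_mat_add:
  "indexed_mat xs ys f + indexed_mat xs ys g = indexed_mat xs ys (\<lambda>x y. f x y + g x y)"
  by (rule eq_matI) (auto simp: indexed_mat_def)

lemma indexed_mat_zero: "indexed_mat xs ys (\<lambda>x y. 0) = 0\<^sub>m (length xs) (length ys)"
  by (rule eq_matI) (auto simp: indexed_mat_def)

lemma indexed_mat_mult:
  fixes f :: "'a \<Rightarrow> 'b \<Rightarrow> 'd :: semiring_0"
  assumes "distinct ys"
  shows "indexed_mat xs ys f * indexed_mat ys zs g
       = indexed_mat xs zs (\<lambda>x z. \<Sum>y\<in>set ys. f x y * g y z)"
proof (rule eq_matI, goal_cases)
  case (1 i j)
  then have "(indexed_mat xs ys f * indexed_mat ys zs g) $$ (i, j)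
      = (\<Sum>k<length ys. f (xs ! i) (ys ! k) * g (ys ! k) (zs ! j))"
    by (simp add: indexed_mat_def scalar_prod_def atLeast0LessThan)
  also have "\<dots> = (\<Sum>y\<in>set ys. f (xs ! i) y * g y (zs ! j))"
    by (rule sum.reindex_bij_betw) (rule bij_betw_nth[OF assms refl refl])
  finally show ?case using 1 by (simp add: indexed_mat_def)
qed auto

section \<open>Characteristic polynomials and eigenvalue multisets of indexed matrices\<close>

lemma poly_char_poly_vertex_mat:
  assumes "distinct xs"
  shows "poly (char_poly (map_mat complex_of_real (vertex_mat xs f))) t =
    det (indexed_mat xs xs (\<lambda>x y. (if x = y then t else 0) - complex_of_real (f x y)))"
proof -
  let ?A = "map_mat complex_of_real (vertex_mat xs f)"
  have A: "?A \<in> carrier_mat (length xs) (length xs)" by (simp add: vertex_mat_def)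
  have "- char_matrix ?A t
      = indexed_mat xs xs (\<lambda>x y. (if x = y then t else 0) - complex_of_real (f x y))"
    by (rule eq_matI)
      (use assms in \<open>auto simp: char_matrix_def vertex_mat_def indexed_mat_def nth_eq_iff_index_eq\<close>)
  then show ?thesis using char_poly_matrix[OF A] by simp
qed

lemma monic_char_poly_vertex_mat:
  "lead_coeff (char_poly (map_mat complex_of_real (vertex_mat xs f))) = 1"
  "degree (char_poly (map_mat complex_of_real (vertex_mat xs f))) = length xs"
  using degree_monic_char_poly[of "map_mat complex_of_real (vertex_mat xs f)" "length xs"]
  by (auto simp: vertex_mat_def)

lemma char_poly_vertex_mat_nonzero:
  "char_poly (map_mat complex_of_real (vertex_mat xs f)) \<noteq> 0"
  using monic_char_poly_vertex_mat(1)[of xs f] by auto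

lemma size_eigenvalue_mset: "size (eigenvalue_mset (vertex_mat xs f)) = length xs"
  by (simp add: eigenvalue_mset_def size_proots_complex monic_char_poly_vertex_mat)

lemma char_poly_eq_prod_eigenvalues:
  "char_poly (map_mat complex_of_real (vertex_mat xs f)) =
     (\<Prod>l\<in>#eigenvalue_mset (vertex_mat xs f). [:-l, 1:])"
  using complex_poly_decompose_multiset[of "char_poly (map_mat complex_of_real (vertex_mat xs f))"]
  unfolding eigenvalue_mset_def monic_char_poly_vertex_mat(1) by simp

lemma prod_mset_const: "(\<Prod>x\<in>#A. c) = c ^ size A" for c :: "'a :: comm_monoid_mult"
  by (induction A) auto

lemma poly_prod_mset_linear: "poly (\<Prod>l\<in>#S. [:-l, 1:]) c = (\<Prod>l\<in>#S. c - l)"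
  for c :: "'a :: comm_ring_1"
  by (induction S) (auto simp: algebra_simps)

text \<open>For nonzero \<open>b\<close>, pulling out \<open>-b\<close> leaves the characteristic
  polynomial evaluated at \<open>-a/b\<close>. The case \<open>b = 0\<close> is treated as well
  because the pencil met later has \<open>b = 2 * t\<close> for arbitrary \<open>t\<close>.\<close>

lemma det_pencil_eq_prod_eigenvalues:
  assumes "distinct xs"
  shows "det (indexed_mat xs xs (\<lambda>x y. (if x = y then a else 0) + b * complex_of_real (f x y))) =
    (\<Prod>l\<in>#eigenvalue_mset (vertex_mat xs f). a + b * l)"
proof (cases "b = 0")
  case True
  have "indexed_mat xs xs (\<lambda>x y. if x = y then a else 0) = a \<cdot>\<^sub>m 1\<^sub>m (length xs)"
    by (rule eq_matI) (use assms in \<open>auto simp: indexed_mat_def nth_eq_iff_index_eq\<close>)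
  then show ?thesis
    using True by (simp add: prod_mset_const size_eigenvalue_mset)
next
  case False
  let ?S = "eigenvalue_mset (vertex_mat xs f)"
  have "indexed_mat xs xs (\<lambda>x y. (if x = y then a else 0) + b * complex_of_real (f x y)) =
     (-b) \<cdot>\<^sub>m indexed_mat xs xs (\<lambda>x y. (if x = y then -a/b else 0) - complex_of_real (f x y))"
    by (rule eq_matI) (use False in \<open>auto simp: indexed_mat_def field_simps\<close>)
  then have "det (indexed_mat xs xs (\<lambda>x y. (if x = y then a else 0) + b * complex_of_real (f x y))) =
     (-b) ^ length xs * poly (\<Prod>l\<in>#?S. [:-l, 1:]) (-a/b)"
    unfolding char_poly_eq_prod_eigenvalues[symmetric] poly_char_poly_vertex_mat[OF assms]
    by simp
  also have "\<dots> = (\<Prod>l\<in>#?S. -b) * (\<Prod>l\<in>#?S. -a/b - l)"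
    by (simp only: prod_mset_const size_eigenvalue_mset poly_prod_mset_linear)
  also have "\<dots> = (\<Prod>l\<in>#?S. -b * (-a/b - l))" by (simp only: prod_mset.distrib)
  also have "(\<lambda>l. -b * (-a/b - l)) = (\<lambda>l. a + b * l)" using False by (auto simp: field_simps)
  finally show ?thesis .
qed

text \<open>
  A determinant lemma without inverses: the column space of \<open>U\<close> is invariant under \<open>E\<close>, so a
  perturbation \<open>U * X\<close> can be evaluated on the \<open>k\<close>-dimensional quotient.
\<close>

lemma det_perturb_invariant:
  fixes E :: "'a :: idom mat"
  assumes E: "E \<in> carrier_mat n n" and U: "U \<in> carrier_mat n k" and X: "X \<in> carrier_mat k n"
    and K: "K \<in> carrier_mat k k" and inv: "E * U = U * K"
  shows "det (E + U * X) * det K = det E * det (K + X * U)"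
proof -
  \<comment> \<open>The determinant of the bordered matrix \<open>W\<close> is computed in two ways
    by triangular column operations. Clearing the lower left block gives
    \<open>det (E + U * X)\<close>; clearing the upper right block, possible because
    \<open>E * U = U * K\<close>, gives the other side.\<close>
  define W where "W = four_block_mat E U (- X) (1\<^sub>m k)"
  have W: "W \<in> carrier_mat (n + k) (n + k)" using E by (simp add: W_def)
  have c: "four_block_mat (1\<^sub>m n) (0\<^sub>m n k) X (1\<^sub>m k) \<in> carrier_mat (n + k) (n + k)"
    "four_block_mat (1\<^sub>m n) (- U) (0\<^sub>m k n) K \<in> carrier_mat (n + k) (n + k)"
    using K by auto
  have "W * four_block_mat (1\<^sub>m n) (0\<^sub>m n k) X (1\<^sub>m k)
      = four_block_mat (E + U * X) U (0\<^sub>m k n) (1\<^sub>m k)"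
    unfolding W_def
    by (subst mult_four_block_mat[OF E U uminus_carrier_mat[OF X]])
      (use E U X in \<open>auto intro!: cong_four_block_mat\<close>)
  moreover have "det (four_block_mat (1\<^sub>m n) (0\<^sub>m n k) X (1\<^sub>m k)) = 1"
    by (subst det_four_block_mat_upper_right_zero[OF _ refl X]) auto
  moreover have "det (four_block_mat (E + U * X) U (0\<^sub>m k n) (1\<^sub>m k)) = det (E + U * X)"
    by (subst det_four_block_mat_lower_left_zero[OF _ U refl]) (use E U X in auto)
  ultimately have 1: "det W = det (E + U * X)"
    using det_mult[OF W c(1)] by simp
  have "W * four_block_mat (1\<^sub>m n) (- U) (0\<^sub>m k n) K
      = four_block_mat E (0\<^sub>m n k) (- X) (K + X * U)"
    unfolding W_def
    by (subst mult_four_block_mat[OF E U uminus_carrier_mat[OF X]])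
      (use E U X K inv in \<open>auto intro!: cong_four_block_mat simp: comm_add_mat[of _ k k]\<close>)
  moreover have "det (four_block_mat (1\<^sub>m n) (- U) (0\<^sub>m k n) K) = det K"
    by (subst det_four_block_mat_lower_left_zero[OF _ _ refl K]) (use U in auto)
  moreover have "det (four_block_mat E (0\<^sub>m n k) (- X) (K + X * U)) = det E * det (K + X * U)"
    by (subst det_four_block_mat_upper_right_zero[OF E refl]) (use X U K in auto)
  ultimately have "det W * det K = det E * det (K + X * U)"
    using det_mult[OF W c(2)] by simp
  with 1 show ?thesis by simp
qed

text \<open>A Schur complement without division: right multiplication by a block triangular
  \<open>Z\<close> of determinant \<open>c ^ n\<close> clears the lower left block. The powers of
  \<open>c\<close> stay on both sides so that \<open>c = 0\<close> is allowed; later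
  \<open>c = t + 2\<close>.\<close>

lemma det_four_block_mat_scalar:
  fixes P :: "'a :: idom mat"
  assumes P: "P \<in> carrier_mat n n" and Q: "Q \<in> carrier_mat n m" and R: "R \<in> carrier_mat m n"
  shows "det (four_block_mat P Q R (c \<cdot>\<^sub>m 1\<^sub>m m)) * c ^ n = det (c \<cdot>\<^sub>m P - Q * R) * c ^ m"
proof -
  define W where "W = four_block_mat P Q R (c \<cdot>\<^sub>m 1\<^sub>m m)"
  define Z where "Z = four_block_mat (c \<cdot>\<^sub>m 1\<^sub>m n) (0\<^sub>m n m) (- R) (1\<^sub>m m)"
  have W: "W \<in> carrier_mat (n + m) (n + m)" and Z: "Z \<in> carrier_mat (n + m) (n + m)"
    using P by (simp_all add: W_def Z_def)
  have "c \<cdot>\<^sub>m P + Q * - R = c \<cdot>\<^sub>m P - Q * R"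
    by (rule eq_matI) (use P Q R in auto)
  moreover have "c \<cdot>\<^sub>m R + - (c \<cdot>\<^sub>m R) = 0\<^sub>m m n" by (rule eq_matI) (use R in auto)
  ultimately have "W * Z = four_block_mat (c \<cdot>\<^sub>m P - Q * R) Q (0\<^sub>m m n) (c \<cdot>\<^sub>m 1\<^sub>m m)"
    unfolding W_def Z_def
    by (subst mult_four_block_mat[OF P Q R])
      (use P Q R in \<open>auto intro!: cong_four_block_mat simp: mult_smult_distrib mult_smult_assoc_mat[of _ m m]\<close>)
  moreover have "det (four_block_mat (c \<cdot>\<^sub>m P - Q * R) Q (0\<^sub>m m n) (c \<cdot>\<^sub>m 1\<^sub>m m)) =
      det (c \<cdot>\<^sub>m P - Q * R) * c ^ m"
    by (subst det_four_block_mat_lower_left_zero[OF _ Q refl]) (use P Q R in auto)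
  moreover have "det Z = c ^ n"
    unfolding Z_def by (subst det_four_block_mat_upper_right_zero[OF _ refl]) (use R in auto)
  ultimately show ?thesis using det_mult[OF W Z] by (simp flip: W_def)
qed

section \<open>Bounding eigenvalues by absolute row sums\<close>

text \<open>Read the eigenvector equation at a coordinate of maximal modulus: there the row sum
  bounds the scaling factor.\<close>

lemma eigenvalue_mset_bound:
  assumes xs: "distinct xs" and l: "l \<in># eigenvalue_mset (vertex_mat xs f)"
    and row: "\<And>x. x \<in> set xs \<Longrightarrow> (\<Sum>y\<in>set xs. \<bar>f x y\<bar>) \<le> r"
  shows "cmod l \<le> r"
proof -
  let ?A = "map_mat complex_of_real (vertex_mat xs f)"
  let ?n = "length xs"
  have A: "?A \<in> carrier_mat ?n ?n" by (simp add: vertex_mat_def)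
  have "poly (char_poly ?A) l = 0"
    using l char_poly_vertex_mat_nonzero[of xs f] by (simp add: eigenvalue_mset_def)
  then obtain v where v: "v \<in> carrier_vec ?n" "v \<noteq> 0\<^sub>v ?n" "?A *\<^sub>v v = l \<cdot>\<^sub>v v"
    using eigenvalue_root_char_poly[OF A] A by (auto simp: eigenvalue_def eigenvector_def)
  obtain k where k: "k < ?n" "v $ k \<noteq> 0" using v(1,2) by (auto simp: vec_eq_iff)
  define M where "M = Max ((\<lambda>i. cmod (v $ i)) ` {..<?n})"
  have fin: "finite ((\<lambda>i. cmod (v $ i)) ` {..<?n})" "(\<lambda>i. cmod (v $ i)) ` {..<?n} \<noteq> {}"
    using k by auto
  have le: "cmod (v $ j) \<le> M" if "j < ?n" for j
    unfolding M_def by (rule Max_ge) (use that in auto)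
  obtain i where i: "i < ?n" "cmod (v $ i) = M"
    using Max_in[OF fin] unfolding M_def by (metis (lifting) imageE lessThan_iff)
  have M: "M > 0" using le[OF k(1)] k(2) by (smt (verit) zero_less_norm_iff)
  have "l * v $ i = (?A *\<^sub>v v) $ i" using v i by simp
  also have "\<dots> = (\<Sum>j<?n. complex_of_real (f (xs ! i) (xs ! j)) * v $ j)"
    using i v(1) by (simp add: vertex_mat_def scalar_prod_def atLeast0LessThan)
  finally have "cmod l * M = cmod (\<Sum>j<?n. complex_of_real (f (xs ! i) (xs ! j)) * v $ j)"
    using i(2) by (metis norm_mult)
  also have "\<dots> \<le> (\<Sum>j<?n. \<bar>f (xs ! i) (xs ! j)\<bar> * M)"
    by (rule order.trans[OF norm_sum sum_mono]) (auto simp: norm_mult intro!: mult_left_mono le)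
  also have "\<dots> = (\<Sum>y\<in>set xs. \<bar>f (xs ! i) y\<bar>) * M"
    unfolding sum_distrib_right
    by (rule sum.reindex_bij_betw) (rule bij_betw_nth[OF xs refl refl])
  also have "\<dots> \<le> r * M" using row[of "xs ! i"] i(1) M by (intro mult_right_mono) auto
  finally show ?thesis using M by simp
qed

section \<open>Regular graphs\<close>

text \<open>A potential that rises by at most one along each arc bounds every walk length from
  below. Stepping back repeatedly to a tail of potential one less ends at \<open>u\<close> and
  yields a walk of length exactly \<open>h v\<close>.\<close>

lemma (in wf_digraph) \<mu>_eq_potential:
  fixes h :: "'a \<Rightarrow> nat"
  assumes u: "u \<in> verts G" "h u = 0"
    and step: "\<And>e. e \<in> arcs G \<Longrightarrow> h (head G e) \<le> Suc (h (tail G e))"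
    and pred: "\<And>v. v \<in> verts G \<Longrightarrow> v \<noteq> u \<Longrightarrow>
      \<exists>e\<in>arcs G. head G e = v \<and> h v = Suc (h (tail G e))"
    and v: "v \<in> verts G"
  shows "\<mu> (\<lambda>_. 1) u v = ereal (real (h v))"
proof (rule antisym)
  have cost: "awalk_cost (\<lambda>_. 1) p = real (length p)" for p
    by (induction p) auto
  have len: "h y \<le> h x + length p" if "awalk x p y" for x y p
    using that
  proof (induction p arbitrary: x)
    case (Cons e p)
    then have "e \<in> arcs G" "x = tail G e" "awalk (head G e) p y" by (auto simp: awalk_Cons_iff)
    then show ?case using Cons.IH[of "head G e"] step[of e] by simp
  qed (auto simp: awalk_Nil_iff)
  show "ereal (real (h v)) \<le> \<mu> (\<lambda>_. 1) u v"
    unfolding \<mu>_def by (rule INF_greatest) (use len u in \<open>force simp: cost\<close>)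
  have "\<exists>p. awalk u p v \<and> length p = h v"
    using v
  proof (induction "h v" arbitrary: v)
    case 0
    \<comment> \<open>Any other vertex would have positive potential, being one above its
      predecessor.\<close>
    then have "v = u" using pred[of v] by auto
    then show ?case using u by (intro exI[of _ "[]"]) (auto simp: awalk_Nil_iff)
  next
    case (Suc n)
    then have "v \<noteq> u" using u by auto
    then obtain e where e: "e \<in> arcs G" "head G e = v" "h v = Suc (h (tail G e))"
      using pred Suc.prems by blast
    obtain p where p: "awalk u p (tail G e)" "length p = h (tail G e)"
      using Suc.hyps(1)[of "tail G e"] Suc.hyps(2) e by auto
    moreover have "awalk (tail G e) [e] v" using e arc_implies_awalk by blast
    ultimately show ?case using e by (intro exI[of _ "p @ [e]"]) auto
  qed
  then show "\<mu> (\<lambda>_. 1) u v \<le> ereal (real (h v))"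
    using min_cost_le_walk_cost[of u _ v "\<lambda>_. 1"] by (metis cost)
qed

section \<open>Counting neighbours and incidences\<close>

lemma card_neighbours:
  assumes "regular_graph G r" "v \<in> pverts G"
  shows "card {u \<in> pverts G. (v, u) \<in> parcs G} = r"
proof -
  interpret pair_graph G using assms by (simp add: regular_graph_def)
  have "out_arcs (with_proj G) v = Pair v ` {u \<in> pverts G. (v, u) \<in> parcs G}"
    by (auto simp: out_arcs_def dest: in_arcsD2)
  then have "out_degree (with_proj G) v = card {u \<in> pverts G. (v, u) \<in> parcs G}"
    by (simp add: out_degree_def card_image inj_on_def)
  with assms show ?thesis by (simp add: regular_graph_def)
qed

lemma undirected_edgeI: "(u, v) \<in> parcs G \<Longrightarrow> {u, v} \<in> undirected_edges G"
  by (auto simp: undirected_edges_def)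

lemma edges_containing_pair:
  assumes "pair_graph G" "u \<noteq> v"
  shows "{e \<in> undirected_edges G. u \<in> e \<and> v \<in> e} = (if (u, v) \<in> parcs G then {{u, v}} else {})"
proof -
  interpret pair_graph G by fact
  show ?thesis using assms(2) arcs_symmetric by (auto simp: undirected_edges_def)
qed

lemma card_incident_edges:
  assumes "regular_graph G r" "v \<in> pverts G"
  shows "card {e \<in> undirected_edges G. v \<in> e} = r"
proof -
  interpret pair_graph G using assms by (simp add: regular_graph_def)
  have "{e \<in> undirected_edges G. v \<in> e} = (\<lambda>u. {v, u}) ` {u \<in> pverts G. (v, u) \<in> parcs G}"
  proof (intro equalityI subsetI)
    fix e assume "e \<in> {e \<in> undirected_edges G. v \<in> e}"
    then obtain a b where "(a, b) \<in> parcs G" "e = {a, b}" "v = a \<or> v = b"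
      by (auto simp: undirected_edges_def)
    then show "e \<in> (\<lambda>u. {v, u}) ` {u \<in> pverts G. (v, u) \<in> parcs G}"
      using arcs_symmetric[of a b] by (auto dest: in_arcsD1 in_arcsD2)
  qed (auto intro: undirected_edgeI)
  moreover have "inj_on (\<lambda>u. {v, u}) S" for S by (auto simp: inj_on_def doubleton_eq_iff)
  ultimately show ?thesis using card_neighbours[OF assms] by (simp add: card_image)
qed

lemma card_undirected_edge:
  assumes "pair_graph G" "e \<in> undirected_edges G"
  shows "card e = 2"
proof -
  interpret pair_graph G by fact
  show ?thesis using assms(2) no_loops' by (auto simp: undirected_edges_def card_insert_if)
qed

lemma sum_of_bool: "finite A \<Longrightarrow> (\<Sum>x\<in>A. of_bool (P x) :: 'a :: semiring_1) = of_nat (card {x \<in> A. P x})"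
  by (simp add: of_bool_def sum.If_cases Int_def)

text \<open>With adjacency matrix \<open>A\<close>, incidence matrix \<open>B\<close> and all-ones
  vector \<open>1\<close>, these are the entries of \<open>A 1 = r 1\<close>,
  \<open>B 1 = r 1\<close>, \<open>B^T 1 = 2 1\<close> and \<open>B B^T = A + r I\<close>. The last
  holds because two distinct vertices share an edge exactly when adjacent.\<close>

lemma incidence_sums:
  assumes G: "regular_graph G r"
  shows "v \<in> pverts G \<Longrightarrow> (\<Sum>u\<in>pverts G. of_bool ((v, u) \<in> parcs G)) = (of_nat r :: 'c :: semiring_1)"
    and "v \<in> pverts G \<Longrightarrow> (\<Sum>e\<in>undirected_edges G. of_bool (v \<in> e)) = (of_nat r :: 'c)"
    and "e \<in> undirected_edges G \<Longrightarrow> (\<Sum>v\<in>pverts G. of_bool (v \<in> e)) = (2 :: 'c)"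
    and "u \<in> pverts G \<Longrightarrow> (\<Sum>e\<in>undirected_edges G. of_bool (u \<in> e) * of_bool (v \<in> e)) =
       (if u = v then of_nat r else of_bool ((u, v) \<in> parcs G) :: 'c)"
proof -
  have P: "pair_graph G" using G by (simp add: regular_graph_def)
  interpret pair_graph G by (fact P)
  note fin = finite_undirected_edges[OF P] pair_finite_verts
  show "v \<in> pverts G \<Longrightarrow> (\<Sum>u\<in>pverts G. of_bool ((v, u) \<in> parcs G)) = (of_nat r :: 'c)"
    by (simp only: sum_of_bool[OF fin(2)] card_neighbours[OF G])
  show inc: "v \<in> pverts G \<Longrightarrow> (\<Sum>e\<in>undirected_edges G. of_bool (v \<in> e)) = (of_nat r :: 'c)" for v
    by (simp only: sum_of_bool[OF fin(1)] card_incident_edges[OF G])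
  show "(\<Sum>v\<in>pverts G. of_bool (v \<in> e)) = (2 :: 'c)" if e: "e \<in> undirected_edges G"
  proof -
    have "{v \<in> pverts G. v \<in> e} = e" using undirected_edges_subset[OF P e] by auto
    then show ?thesis by (simp only: sum_of_bool[OF fin(2)] card_undirected_edge[OF P e]) simp
  qed
  show "(\<Sum>e\<in>undirected_edges G. of_bool (u \<in> e) * of_bool (v \<in> e)) =
       (if u = v then of_nat r else of_bool ((u, v) \<in> parcs G) :: 'c)" if u: "u \<in> pverts G"
  proof (cases "u = v")
    case True
    then show ?thesis using inc[OF u] by (simp flip: of_bool_conj)
  next
    case False
    then show ?thesis
      by (simp only: sum_of_bool[OF fin(1)] edges_containing_pair[OF P False] flip: of_bool_conj) simp
  qed
qed

text \<open>Double counting of incident vertex-edge pairs.\<close>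

lemma handshake:
  assumes G: "regular_graph G r"
  shows "2 * card (undirected_edges G) = card (pverts G) * r"
proof -
  have "(\<Sum>e\<in>undirected_edges G. \<Sum>v\<in>pverts G. of_bool (v \<in> e))
      = (\<Sum>v\<in>pverts G. \<Sum>e\<in>undirected_edges G. of_bool (v \<in> e) :: nat)"
    by (rule sum.swap)
  then show ?thesis
    by (simp only: incidence_sums[OF G] sum_constant cong: sum.cong) simp
qed

section \<open>The diagonal block of one graph and its determinant\<close>

text \<open>These are the entries of \<open>t I - D\<close> inside one graph after adding the
  generic distances 4, 3, 3, 2 between its original and inserted vertices; only equality, adjacency
  and incidence survive.\<close>

fun sub_block :: "'a pair_pre_digraph \<Rightarrow> complex \<Rightarrow> 'a + 'a set \<Rightarrow> 'a + 'a set \<Rightarrow> complex" where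
  "sub_block G t (Inl u) (Inl v) = (if u = v then t + 4 else 0) + 2 * of_bool ((u, v) \<in> parcs G)"
| "sub_block G t (Inl u) (Inr e) = 2 * of_bool (u \<in> e)"
| "sub_block G t (Inr e) (Inl u) = 2 * of_bool (u \<in> e)"
| "sub_block G t (Inr e) (Inr f) = (if e = f then t + 2 else 0)"

text \<open>Eliminating the edge coordinates through the scalar block \<open>(t + 2) I\<close>
  leaves \<open>(t + 2) ((t + 4) I + 2 A) - 4 (A + r I)\<close>, which is
  \<open>(t^2 + 6 t + 8 - 4 r) I + 2 t A\<close>, a pencil in \<open>A\<close> alone.\<close>

lemma det_sub_block:
  assumes G: "regular_graph G r"
    and vs: "distinct vs" "set vs = pverts G"
    and es: "distinct es" "set es = undirected_edges G"
    and ws: "ws = map Inl vs @ map Inr es"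
  shows "det (indexed_mat ws ws (sub_block G t)) * (t + 2) ^ length vs =
    (t + 2) ^ length es *
    (\<Prod>l\<in>#adjacency_spectrum G. t\<^sup>2 + (6 + 2 * l) * t + 8 - 4 * of_nat r)"
proof -
  interpret pair_graph G using G by (simp add: regular_graph_def)
  let ?P = "indexed_mat vs vs (\<lambda>u v. sub_block G t (Inl u) (Inl v))"
  let ?Q = "indexed_mat vs es (\<lambda>u e. 2 * of_bool (u \<in> e)) :: complex mat"
  let ?R = "indexed_mat es vs (\<lambda>e u. 2 * of_bool (u \<in> e)) :: complex mat"
  let ?a = "t\<^sup>2 + 6 * t + 8 - 4 * of_nat r"
  let ?adj = "\<lambda>u v. if (u, v) \<in> parcs G then 1 else 0 :: real"
  have "indexed_mat ws ws (sub_block G t) = four_block_mat ?P ?Q ?R ((t + 2) \<cdot>\<^sub>m 1\<^sub>m (length es))"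
    unfolding ws indexed_mat_append indexed_mat_map
    by (rule cong_four_block_mat)
      (use es in \<open>auto simp: indexed_mat_def nth_eq_iff_index_eq\<close>)
  then have "det (indexed_mat ws ws (sub_block G t)) * (t + 2) ^ length vs
      = det ((t + 2) \<cdot>\<^sub>m ?P - ?Q * ?R) * (t + 2) ^ length es"
    by (simp add: det_four_block_mat_scalar)
  also have "(t + 2) \<cdot>\<^sub>m ?P - ?Q * ?R = (t + 2) \<cdot>\<^sub>m ?P - indexed_mat vs vs
      (\<lambda>u v. 4 * (\<Sum>e\<in>undirected_edges G. of_bool (u \<in> e) * of_bool (v \<in> e)))"
    using es by (simp add: indexed_mat_mult sum_distrib_left mult_ac)
  also have "\<dots> = indexed_mat vs vs
      (\<lambda>u v. (t + 2) * sub_block G t (Inl u) (Inl v) -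
         4 * (\<Sum>e\<in>undirected_edges G. of_bool (u \<in> e) * of_bool (v \<in> e)))"
    by (rule eq_matI) (auto simp: indexed_mat_def)
  also have "\<dots> = indexed_mat vs vs
      (\<lambda>u v. (if u = v then ?a else 0) + 2 * t * complex_of_real (?adj u v))"
    by (rule indexed_mat_cong)
      (auto simp: incidence_sums[OF G] vs no_loops' algebra_simps power2_eq_square)
  also have "det \<dots> = (\<Prod>l\<in>#adjacency_spectrum G. ?a + 2 * t * l)"
    unfolding adjacency_spectrum_def indexed_eigenvalues_eq[OF vs]
    by (rule det_pencil_eq_prod_eigenvalues) (rule vs)
  also have "(\<lambda>l. ?a + 2 * t * l) = (\<lambda>l. t\<^sup>2 + (6 + 2 * l) * t + 8 - 4 * of_nat r)"
    by (auto simp: algebra_simps)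
  finally show ?thesis by simp
qed

text \<open>Each row of the adjacency matrix sums to \<open>r\<close>. For real eigenvalues
  \<open>l\<close> this gives \<open>l + r\<close> nonnegative, so the square roots in the spectrum
  are real.\<close>

lemma adjacency_spectrum_bound:
  assumes G: "regular_graph G r" and l: "l \<in># adjacency_spectrum G"
  shows "cmod l \<le> real r"
proof -
  interpret pair_graph G using G by (simp add: regular_graph_def)
  obtain vs where vs: "distinct vs" "set vs = pverts G"
    using finite_distinct_list[OF pair_finite_verts] by auto
  show ?thesis
  proof (rule eigenvalue_mset_bound[OF vs(1)])
    show "l \<in># eigenvalue_mset (vertex_mat vs (\<lambda>u v. if (u, v) \<in> parcs G then 1 else 0))"
      using l by (simp add: adjacency_spectrum_def indexed_eigenvalues_eq[OF vs])
    show "(\<Sum>v\<in>set vs. \<bar>if (u, v) \<in> parcs G then 1 else 0\<bar>) \<le> real r" if "u \<in> set vs" for u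
      using incidence_sums(1)[OF G, of u, where ?'c = real] that vs
      by (simp add: of_bool_def if_distrib[of abs] cong: if_cong)
  qed
qed

lemma size_adjacency_spectrum:
  assumes "pair_graph G"
  shows "size (adjacency_spectrum G) = card (pverts G)"
proof -
  interpret pair_graph G by fact
  obtain vs where vs: "distinct vs" "set vs = pverts G"
    using finite_distinct_list[OF pair_finite_verts] by auto
  then show ?thesis
    by (simp add: adjacency_spectrum_def indexed_eigenvalues_eq[OF vs] size_eigenvalue_mset
        flip: distinct_card)
qed

section \<open>Distances in the join\<close>

text \<open>
  The values 4 and 2 for non-adjacent vertices and for distinct edges come from paths through
  the other graph; \<open>sub_dist\<close> is not the distance within the subdivision graph.
\<close>

fun sub_dist :: "'a pair_pre_digraph \<Rightarrow> 'a + 'a set \<Rightarrow> 'a + 'a set \<Rightarrow> nat" where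
  "sub_dist G (Inl u) (Inl v) = (if u = v then 0 else if (u, v) \<in> parcs G then 2 else 4)"
| "sub_dist G (Inl u) (Inr e) = (if u \<in> e then 1 else 3)"
| "sub_dist G (Inr e) (Inl u) = (if u \<in> e then 1 else 3)"
| "sub_dist G (Inr e) (Inr f) = (if e = f then 0 else 2)"

text \<open>The distance to a nearest inserted vertex.\<close>

fun depth :: "'a + 'b \<Rightarrow> nat" where
  "depth (Inl _) = 1"
| "depth (Inr _) = 0"

fun join_dist :: "'a pair_pre_digraph \<Rightarrow> 'b pair_pre_digraph \<Rightarrow>
  ('a + 'a set) + ('b + 'b set) \<Rightarrow> ('a + 'a set) + ('b + 'b set) \<Rightarrow> nat" where
  "join_dist G H (Inl x) (Inl y) = sub_dist G x y"
| "join_dist G H (Inl x) (Inr y) = depth x + depth y + 1"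
| "join_dist G H (Inr x) (Inl y) = depth x + depth y + 1"
| "join_dist G H (Inr x) (Inr y) = sub_dist H x y"

lemma join_arcs_simps:
  "(Inl x, Inl y) \<in> parcs (subdivision_edge_join G H) \<longleftrightarrow> (x, y) \<in> parcs (subdivision_graph G)"
  "(Inr x', Inr y') \<in> parcs (subdivision_edge_join G H) \<longleftrightarrow> (x', y') \<in> parcs (subdivision_graph H)"
  "(Inl x, Inr y') \<in> parcs (subdivision_edge_join G H) \<longleftrightarrow>
     x \<in> inserted_vertices G \<and> y' \<in> inserted_vertices H"
  "(Inr x', Inl y) \<in> parcs (subdivision_edge_join G H) \<longleftrightarrow>
     y \<in> inserted_vertices G \<and> x' \<in> inserted_vertices H"
  by (force simp: subdivision_edge_join_def Let_def)+

lemma pverts_join: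
  "pverts (subdivision_edge_join G H) =
     (pverts G <+> undirected_edges G) <+> (pverts H <+> undirected_edges H)"
  by (auto simp: subdivision_edge_join_def Let_def subdivision_graph_def inserted_vertices_def)

lemma sub_dist_self: "sub_dist G x x = 0"
  by (cases x) auto

lemma sub_dist_arc:
  assumes "pair_graph G" "(y, z) \<in> parcs (subdivision_graph G)"
  shows "sub_dist G x z \<le> Suc (sub_dist G x y)" "depth z \<le> Suc (depth y)"
proof -
  interpret pair_graph G by fact
  \<comment> \<open>Distinct ends of an edge are adjacent, so passing through an incident edge can
    never lead from value 1 to value 4.\<close>
  have *: "(a, b) \<in> parcs G" if "a \<in> e" "b \<in> e" "a \<noteq> b" "e \<in> undirected_edges G" for a b e
    using edges_containing_pair[OF assms(1) that(3)] that by (auto split: if_splits)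
  show "sub_dist G x z \<le> Suc (sub_dist G x y)"
    using assms(2) by (cases x) (auto simp: subdivision_graph_def subdivision_arcs_def dest: *)
  show "depth z \<le> Suc (depth y)" by (cases z) auto
qed

text \<open>The two bounds control the potential along joining arcs, leaving the graph of
  \<open>x\<close> and returning to it respectively.\<close>

lemma depth_le_sub_dist:
  "depth x \<le> sub_dist G x (Inr e)" "sub_dist G x (Inr e) \<le> depth x + 2"
  by (cases x; simp)+

lemma incident_edge_exists:
  assumes "regular_graph G r" "r > 0" "v \<in> pverts G"
  obtains e where "e \<in> undirected_edges G" "v \<in> e"
proof -
  have "{e \<in> undirected_edges G. v \<in> e} \<noteq> {}"
    using card_incident_edges[OF assms(1,3)] assms(2) by (metis card.empty less_numeral_extra(3))
  then show ?thesis using that by auto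
qed

text \<open>The first alternative supplies the previous vertex of a shortest path inside the same
  graph. The second covers targets reached through the other graph: go to a nearest inserted vertex,
  cross over, and come back, at cost \<open>depth x + 2\<close>.\<close>

lemma sub_dist_predecessor:
  assumes G: "regular_graph G r" "r > 0"
    and x: "x \<in> pverts G <+> undirected_edges G" and z: "z \<in> pverts G <+> undirected_edges G" "z \<noteq> x"
  shows "(\<exists>y. (y, z) \<in> parcs (subdivision_graph G) \<and> sub_dist G x z = Suc (sub_dist G x y)) \<or>
    (z \<in> inserted_vertices G \<and> sub_dist G x z = depth x + 2)"
proof -
  have arc: "(Inr e, Inl v) \<in> parcs (subdivision_graph G)" "(Inl v, Inr e) \<in> parcs (subdivision_graph G)"
    if "e \<in> undirected_edges G" "v \<in> e" for v e
    using that by (auto simp: subdivision_graph_def subdivision_arcs_def)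
  show ?thesis
  proof (cases z)
    case (Inl v)
    then obtain e where e: "e \<in> undirected_edges G" "v \<in> e"
      using incident_edge_exists[OF G] z by auto
    show ?thesis
    proof (cases x)
      case x: (Inl u)
      show ?thesis
      proof (cases "(u, v) \<in> parcs G")
        case True
        then show ?thesis using x Inl z undirected_edgeI[of u v G]
          by (intro disjI1 exI[of _ "Inr {u, v}"]) (auto intro: arc)
      next
        case False
        have "pair_graph G" using G by (simp add: regular_graph_def)
        \<comment> \<open>As \<open>u\<close> and \<open>v\<close> are distinct and non-adjacent, an
          edge at \<open>v\<close> misses \<open>u\<close>; it therefore has value 3, one below the
          value 4 of \<open>v\<close>.\<close>
        then have "u \<notin> e"
          using edges_containing_pair[of G u v] False x Inl z e by auto
        then show ?thesis using x Inl z False e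
          by (intro disjI1 exI[of _ "Inr e"]) (auto intro: arc)
      qed
    next
      case x': (Inr f)
      then have f: "f \<in> undirected_edges G" using x by auto
      show ?thesis
      proof (cases "v \<in> f")
        case True
        then show ?thesis using x' Inl f by (intro disjI1 exI[of _ x]) (auto intro: arc)
      next
        case False
        then show ?thesis using x' Inl f e by (intro disjI1 exI[of _ "Inr e"]) (auto intro: arc)
      qed
    qed
  next
    case (Inr e)
    then have e: "e \<in> undirected_edges G" using z by auto
    show ?thesis
    proof (cases "\<exists>u\<in>e. x = Inl u")
      case True
      then show ?thesis using Inr e by (intro disjI1 exI[of _ x]) (auto intro: arc)
    next
      case False
      then show ?thesis using Inr e z by (cases x) (auto simp: inserted_vertices_def)
    qed
  qed
qed

text \<open>Describes how a path coming from the other graph ends: directly at an inserted vertex,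
  or one step beyond it.\<close>

lemma inserted_or_adjacent_inserted:
  assumes "regular_graph G r" "r > 0" "z \<in> pverts G <+> undirected_edges G"
  shows "z \<in> inserted_vertices G \<or>
    (depth z = 1 \<and> (\<exists>y \<in> inserted_vertices G. (y, z) \<in> parcs (subdivision_graph G)))"
proof (cases z)
  case (Inl v)
  then obtain e where "e \<in> undirected_edges G" "v \<in> e"
    using incident_edge_exists[OF assms(1,2)] assms(3) by auto
  then show ?thesis using Inl
    by (auto simp: inserted_vertices_def subdivision_graph_def subdivision_arcs_def)
qed (use assms(3) in \<open>auto simp: inserted_vertices_def\<close>)

text \<open>Supplies the inserted vertex from which a shortest path crosses to the other
  graph.\<close>

lemma inserted_at_depth:
  assumes "regular_graph G r" "r > 0" "x \<in> pverts G <+> undirected_edges G"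
  shows "\<exists>y \<in> inserted_vertices G. sub_dist G x y = depth x"
proof (cases x)
  case (Inl v)
  then obtain e where "e \<in> undirected_edges G" "v \<in> e"
    using incident_edge_exists[OF assms(1,2)] assms(3) by auto
  then show ?thesis using Inl by (auto simp: inserted_vertices_def)
qed (use assms(3) in \<open>auto simp: inserted_vertices_def\<close>)

lemma depth_inserted: "x \<in> inserted_vertices G \<Longrightarrow> depth x = 0"
  by (auto simp: inserted_vertices_def)

text \<open>\<open>join_dist G H x\<close> is a potential in the sense of
  \<open>\<mu>_eq_potential\<close>. Positive degrees put every original vertex next to an inserted
  one, and nonempty vertex sets then provide inserted vertices on both sides for detours.\<close>

lemma graph_distance_join:
  fixes G :: "'a pair_pre_digraph" and H :: "'b pair_pre_digraph"
  assumes G: "regular_graph G r" "r > 0" "pverts G \<noteq> {}"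
    and H: "regular_graph H s" "s > 0" "pverts H \<noteq> {}"
    and xy: "x \<in> pverts (subdivision_edge_join G H)" "y \<in> pverts (subdivision_edge_join G H)"
  shows "graph_distance (subdivision_edge_join G H) x y = real (join_dist G H x y)"
proof -
  let ?J = "subdivision_edge_join G H"
  have P: "pair_graph G" "pair_graph H" using G H by (simp_all add: regular_graph_def)
  interpret pair_graph ?J by (rule pair_graph_subdivision_edge_join[OF P])
  obtain f where f: "f \<in> inserted_vertices G"
    using inserted_at_depth[OF G(1,2)] G(3) by auto
  obtain g where g: "g \<in> inserted_vertices H"
    using inserted_at_depth[OF H(1,2)] H(3) by auto
  have pred: "\<exists>y. (y, z) \<in> parcs ?J \<and> join_dist G H x z = Suc (join_dist G H x y)"
    if z: "z \<in> pverts ?J" "z \<noteq> x" for z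
  proof (cases x; cases z)
    fix x' z' assume eq: "x = Inl x'" "z = Inl z'"
    then consider y where "(y, z') \<in> parcs (subdivision_graph G)" "sub_dist G x' z' = Suc (sub_dist G x' y)"
      | "z' \<in> inserted_vertices G" "sub_dist G x' z' = depth x' + 2"
      using sub_dist_predecessor[OF G(1,2), of x' z'] xy z by (auto simp: pverts_join)
    then show ?thesis
    proof cases
      case 1
      then show ?thesis using eq by (intro exI[of _ "Inl y"]) (auto simp: join_arcs_simps)
    next
      \<comment> \<open>The detour returns through the inserted vertex \<open>g\<close> of the other
        graph, whose value is \<open>depth x' + 1\<close>.\<close>
      case 2
      then show ?thesis using eq g
        by (intro exI[of _ "Inr g"]) (auto simp: join_arcs_simps depth_inserted)
    qed
  next
    fix x' z' assume eq: "x = Inr x'" "z = Inr z'"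
    then consider y where "(y, z') \<in> parcs (subdivision_graph H)" "sub_dist H x' z' = Suc (sub_dist H x' y)"
      | "z' \<in> inserted_vertices H" "sub_dist H x' z' = depth x' + 2"
      using sub_dist_predecessor[OF H(1,2), of x' z'] xy z by (auto simp: pverts_join)
    then show ?thesis
    proof cases
      case 1
      then show ?thesis using eq by (intro exI[of _ "Inr y"]) (auto simp: join_arcs_simps)
    next
      case 2
      then show ?thesis using eq f
        by (intro exI[of _ "Inl f"]) (auto simp: join_arcs_simps depth_inserted)
    qed
  next
    fix x' z' assume eq: "x = Inl x'" "z = Inr z'"
    then consider "z' \<in> inserted_vertices H"
      | y where "depth z' = 1" "y \<in> inserted_vertices H" "(y, z') \<in> parcs (subdivision_graph H)"
      using inserted_or_adjacent_inserted[OF H(1,2), of z'] z by (auto simp: pverts_join)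
    then show ?thesis
    proof cases
      \<comment> \<open>The last arc is a joining arc, so the predecessor is an inserted vertex of
        the first graph at distance \<open>depth x'\<close>.\<close>
      case 1
      obtain y where "y \<in> inserted_vertices G" "sub_dist G x' y = depth x'"
        using inserted_at_depth[OF G(1,2), of x'] xy eq by (auto simp: pverts_join)
      then show ?thesis using eq 1
        by (intro exI[of _ "Inl y"]) (auto simp: join_arcs_simps depth_inserted)
    next
      case 2
      then show ?thesis using eq
        by (intro exI[of _ "Inr y"]) (auto simp: join_arcs_simps depth_inserted)
    qed
  next
    fix x' z' assume eq: "x = Inr x'" "z = Inl z'"
    then consider "z' \<in> inserted_vertices G"
      | y where "depth z' = 1" "y \<in> inserted_vertices G" "(y, z') \<in> parcs (subdivision_graph G)"
      using inserted_or_adjacent_inserted[OF G(1,2), of z'] z by (auto simp: pverts_join)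
    then show ?thesis
    proof cases
      case 1
      obtain y where "y \<in> inserted_vertices H" "sub_dist H x' y = depth x'"
        using inserted_at_depth[OF H(1,2), of x'] xy eq by (auto simp: pverts_join)
      then show ?thesis using eq 1
        by (intro exI[of _ "Inr y"]) (auto simp: join_arcs_simps depth_inserted)
    next
      case 2
      then show ?thesis using eq
        by (intro exI[of _ "Inl y"]) (auto simp: join_arcs_simps depth_inserted)
    qed
  qed
  have step: "join_dist G H x z \<le> Suc (join_dist G H x y)" if "(y, z) \<in> parcs ?J" for y z
    using that
    by (cases x; cases y; cases z)
      (auto simp: join_arcs_simps sub_dist_arc[OF P(1)] sub_dist_arc[OF P(2)]
        inserted_vertices_def depth_le_sub_dist intro: order.trans[OF depth_le_sub_dist(2)])
  have "wf_digraph.\<mu> (with_proj ?J) (\<lambda>_. 1) x y = ereal (real (join_dist G H x y))"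
  proof (rule \<mu>_eq_potential[where h = "join_dist G H x"])
    show "join_dist G H x x = 0" by (cases x) (auto simp: sub_dist_self)
    show "\<exists>e\<in>parcs ?J. snd e = v \<and> join_dist G H x v = Suc (join_dist G H x (fst e))"
      if "v \<in> pverts ?J" "v \<noteq> x" for v
      using pred[of v] that by force
  qed (use xy step in auto)
  then show ?thesis by (simp add: graph_distance_def)
qed

section \<open>Connectedness forces positive degrees\<close>

lemma connected_graph_has_arc:
  assumes J: "pair_graph J" and "connected_graph J" and xy: "x \<in> pverts J" "y \<in> pverts J" "x \<noteq> y"
  shows "\<exists>z. (x, z) \<in> parcs J"
proof -
  interpret pair_graph J by fact
  have "x \<rightarrow>\<^sup>*\<^bsub>with_proj (mk_symmetric (with_proj J))\<^esub> y"
    using assms(2) xy unfolding connected_graph_def connected_def by auto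
  then have "x \<rightarrow>\<^sup>*\<^bsub>with_proj J\<^esub> y"
    using reachable_mk_symmetric_eq sym_arcs by blast
  then show ?thesis using xy(3) by (auto elim: converse_reachable_cases)
qed

lemma positive_degree:
  assumes G: "regular_graph G r" and v: "v \<in> pverts G"
    and arc: "(Inl v, z) \<in> parcs (subdivision_graph G)"
  shows "r > 0"
proof -
  have "finite (undirected_edges G)"
    using G finite_undirected_edges by (auto simp: regular_graph_def)
  then have "finite {e \<in> undirected_edges G. v \<in> e}" by simp
  moreover have "{e \<in> undirected_edges G. v \<in> e} \<noteq> {}"
    using arc by (auto simp: subdivision_graph_def subdivision_arcs_def)
  ultimately have "card {e \<in> undirected_edges G. v \<in> e} > 0" by (subst card_gt_0_iff) blast
  then show ?thesis by (simp only: card_incident_edges[OF G v])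
qed

text \<open>Joining arcs touch only inserted vertices, so an arc leaving an original vertex leads to
  an edge incident with it in its own graph.\<close>

lemma join_positive_degrees:
  assumes G: "regular_graph G r" "pverts G \<noteq> {}" and H: "regular_graph H s" "pverts H \<noteq> {}"
    and conn: "connected_graph (subdivision_edge_join G H)"
  shows "r > 0" "s > 0"
proof -
  let ?J = "subdivision_edge_join G H"
  have J: "pair_graph ?J"
    using G H by (simp add: regular_graph_def pair_graph_subdivision_edge_join)
  obtain v w where vw: "v \<in> pverts G" "w \<in> pverts H" using G H by auto
  then have mem: "Inl (Inl v) \<in> pverts ?J" "Inr (Inl w) \<in> pverts ?J" by (auto simp: pverts_join)
  obtain z where z: "(Inl (Inl v), z) \<in> parcs ?J"
    using connected_graph_has_arc[OF J conn mem] by auto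
  then obtain z' where "(Inl v, z') \<in> parcs (subdivision_graph G)"
    by (cases z) (auto simp: join_arcs_simps inserted_vertices_def)
  then show "r > 0" using positive_degree[OF G(1)] vw by blast
  obtain z where z: "(Inr (Inl w), z) \<in> parcs ?J"
    using connected_graph_has_arc[OF J conn mem(2,1)] by auto
  then obtain z' where "(Inl w, z') \<in> parcs (subdivision_graph H)"
    by (cases z) (auto simp: join_arcs_simps inserted_vertices_def)
  then show "s > 0" using positive_degree[OF H(1)] vw by blast
qed

text \<open>Constant row sums over each vertex class make the span of the class indicators
  invariant; the constants are the entries of \<open>block_quotient\<close>.\<close>

lemma sub_block_row_sums:
  assumes G: "regular_graph G r"
  shows "u \<in> pverts G \<Longrightarrow> (\<Sum>v\<in>pverts G. sub_block G t (Inl u) (Inl v)) = t + 4 + 2 * of_nat r"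
    and "u \<in> pverts G \<Longrightarrow> (\<Sum>e\<in>undirected_edges G. sub_block G t (Inl u) (Inr e)) = 2 * of_nat r"
    and "e \<in> undirected_edges G \<Longrightarrow> (\<Sum>v\<in>pverts G. sub_block G t (Inr e) (Inl v)) = 4"
    and "e \<in> undirected_edges G \<Longrightarrow>
      (\<Sum>f\<in>undirected_edges G. sub_block G t (Inr e) (Inr f)) = t + 2"
proof -
  have P: "pair_graph G" using G by (simp add: regular_graph_def)
  interpret pair_graph G by (fact P)
  show "u \<in> pverts G \<Longrightarrow> (\<Sum>v\<in>pverts G. sub_block G t (Inl u) (Inl v)) = t + 4 + 2 * of_nat r"
    by (simp only: sub_block.simps sum.distrib incidence_sums[OF G] sum.delta' pair_finite_verts
        if_True flip: sum_distrib_left)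
  show "u \<in> pverts G \<Longrightarrow> (\<Sum>e\<in>undirected_edges G. sub_block G t (Inl u) (Inr e)) = 2 * of_nat r"
    by (simp only: sub_block.simps incidence_sums[OF G] flip: sum_distrib_left)
  show "e \<in> undirected_edges G \<Longrightarrow> (\<Sum>v\<in>pverts G. sub_block G t (Inr e) (Inl v)) = 4"
    by (simp only: sub_block.simps incidence_sums[OF G] flip: sum_distrib_left) simp
  show "e \<in> undirected_edges G \<Longrightarrow> (\<Sum>f\<in>undirected_edges G. sub_block G t (Inr e) (Inr f)) = t + 2"
    by (simp add: finite_undirected_edges[OF P])
qed

section \<open>The distance spectrum of the join\<close>

text \<open>
  Outside the rank-four part recorded by \<open>class_dist\<close>, the matrix \<open>t I - D\<close> of the join splits
  into one block per graph: \<open>t I - D = join_block - class_dist\<close>, entry by entry.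
\<close>

fun join_block :: "'a pair_pre_digraph \<Rightarrow> 'b pair_pre_digraph \<Rightarrow> complex \<Rightarrow>
  ('a + 'a set) + ('b + 'b set) \<Rightarrow> ('a + 'a set) + ('b + 'b set) \<Rightarrow> complex" where
  "join_block G H t (Inl x) (Inl y) = sub_block G t x y"
| "join_block G H t (Inr x) (Inr y) = sub_block H t x y"
| "join_block G H t (Inl x) (Inr y) = 0"
| "join_block G H t (Inr x) (Inl y) = 0"

fun vertex_class :: "('a + 'b) + ('c + 'd) \<Rightarrow> nat" where
  "vertex_class (Inl (Inl _)) = 0"
| "vertex_class (Inl (Inr _)) = 1"
| "vertex_class (Inr (Inl _)) = 2"
| "vertex_class (Inr (Inr _)) = 3"

text \<open>The generic distance between two classes: that of distinct vertices which are neither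
  adjacent nor incident in one graph, and the exact distance across the two graphs.\<close>

definition class_dist :: "nat \<Rightarrow> nat \<Rightarrow> complex" where
  "class_dist a b = [[4, 3, 3, 2], [3, 2, 2, 1], [3, 2, 4, 3], [2, 1, 3, 2]] ! a ! b"

definition block_quotient :: "complex \<Rightarrow> nat \<Rightarrow> nat \<Rightarrow> nat \<Rightarrow> nat \<Rightarrow> complex" where
  "block_quotient t r s a b =
     [[t + 4 + 2 * of_nat r, 2 * of_nat r, 0, 0], [4, t + 2, 0, 0],
      [0, 0, t + 4 + 2 * of_nat s, 2 * of_nat s], [0, 0, 4, t + 2]] ! a ! b"

text \<open>In the join, entry \<open>(a, b)\<close> is the sum of the distances from a vertex of
  class \<open>a\<close> to all vertices of class \<open>b\<close>, the number of edges being half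
  of \<open>p r\<close>.\<close>

definition quotient_rows :: "nat \<Rightarrow> nat \<Rightarrow> nat \<Rightarrow> nat \<Rightarrow> real list list" where
  "quotient_rows p\<^sub>1 r\<^sub>1 p\<^sub>2 r\<^sub>2 =
       [[4 * real p\<^sub>1 - 2 * real r\<^sub>1 - 4, 3/2 * real p\<^sub>1 * real r\<^sub>1 - 2 * real r\<^sub>1,
         3 * real p\<^sub>2, real p\<^sub>2 * real r\<^sub>2],
        [3 * real p\<^sub>1 - 4, real p\<^sub>1 * real r\<^sub>1 - 2,
         2 * real p\<^sub>2, 1/2 * real p\<^sub>2 * real r\<^sub>2],
        [3 * real p\<^sub>1, real p\<^sub>1 * real r\<^sub>1,
         4 * real p\<^sub>2 - 2 * real r\<^sub>2 - 4, 3/2 * real p\<^sub>2 * real r\<^sub>2 - 2 * real r\<^sub>2],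
        [2 * real p\<^sub>1, 1/2 * real p\<^sub>1 * real r\<^sub>1,
         3 * real p\<^sub>2 - 4, real p\<^sub>2 * real r\<^sub>2 - 2]]"

lemma mat_of_quotient_rows:
  "mat_of_rows_list 4 (quotient_rows p r q s) =
     vertex_mat [0, 1, 2, 3] (\<lambda>i j. quotient_rows p r q s ! i ! j)"
proof -
  have "[0, 1, 2, 3] ! i = i" if "i < 4" for i :: nat
    using that by (auto simp: less_Suc_eq numeral_eq_Suc)
  then show ?thesis
    by (intro eq_matI) (auto simp: mat_of_rows_list_def vertex_mat_def quotient_rows_def)
qed

lemma det_indexed_mat_2: "det (indexed_mat [a] [a] f) = f a a"
  "det (indexed_mat [a, b] [a, b] f) = f a a * f b b - f a b * f b a"
  for f :: "'a \<Rightarrow> 'a \<Rightarrow> 'c :: idom"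
proof -
  show 1: "det (indexed_mat [a] [a] f) = f a a" for a f
    by (subst det_single) (auto simp: indexed_mat_def)
  have "det (indexed_mat ([a] @ [b]) ([a] @ [b]) f) =
    det (indexed_mat [a] [a] f * indexed_mat [b] [b] f - indexed_mat [a] [b] f * indexed_mat [b] [a] f)"
    unfolding indexed_mat_append
    by (rule det_four_block_mat[of _ 1])
      (auto intro!: eq_matI simp: indexed_mat_def scalar_prod_def mult.commute)
  also have "\<dots> = f a a * f b b - f a b * f b a"
    by (subst det_single) (auto simp: indexed_mat_def scalar_prod_def)
  finally show "det (indexed_mat [a, b] [a, b] f) = f a a * f b b - f a b * f b a" by simp
qed

definition block_factor :: "nat \<Rightarrow> complex \<Rightarrow> complex poly" where
  "block_factor r l = [:8 - 4 * of_nat r, 6 + 2 * l, 1:]"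

lemma poly_block_factor: "poly (block_factor r l) t = t\<^sup>2 + (6 + 2 * l) * t + 8 - 4 * of_nat r"
  by (simp add: block_factor_def algebra_simps power2_eq_square)

lemma block_factor_nonzero [simp]: "block_factor r l \<noteq> 0"
  by (simp add: block_factor_def)

text \<open>Each diagonal 2-by-2 block contributes the factor of the eigenvalue \<open>r\<close>,
  which is why the trivial eigenvalues later cancel.\<close>

lemma det_block_quotient:
  "det (indexed_mat [0, 1, 2, 3] [0, 1, 2, 3] (block_quotient t r s)) =
     poly (block_factor r (of_nat r)) t * poly (block_factor s (of_nat s)) t"
proof -
  have zero: "indexed_mat [0, 1] [2, 3] (block_quotient t r s) = 0\<^sub>m 2 2"
    by (rule eq_matI) (auto simp: indexed_mat_def block_quotient_def less_Suc_eq numeral_eq_Suc)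
  have "det (indexed_mat ([0, 1] @ [2, 3]) ([0, 1] @ [2, 3]) (block_quotient t r s)) =
    det (indexed_mat [0, 1] [0, 1] (block_quotient t r s)) *
    det (indexed_mat [2, 3] [2, 3] (block_quotient t r s))"
    unfolding indexed_mat_append
    by (rule det_four_block_mat_upper_right_zero[OF _ zero]) (rule carrier_matI; simp)+
  then show ?thesis
    by (simp add: det_indexed_mat_2 poly_block_factor block_quotient_def algebra_simps power2_eq_square)
qed

text \<open>Stated as a product identity so that nothing is divided by factors vanishing at
  particular \<open>t\<close>. It is proved by evaluation at every complex \<open>t\<close>, and the
  common polynomial factors are cancelled afterwards.\<close>

lemma char_poly_distance_join:
  fixes G :: "'a pair_pre_digraph" and H :: "'b pair_pre_digraph"
  assumes G: "regular_graph G r" "r > 0" "pverts G \<noteq> {}"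
    and H: "regular_graph H s" "s > 0" "pverts H \<noteq> {}"
  defines "J \<equiv> subdivision_edge_join G H"
  assumes xs: "distinct xs" "set xs = pverts J"
  shows "char_poly (map_mat complex_of_real (vertex_mat xs (graph_distance J))) *
      (block_factor r (of_nat r) * block_factor s (of_nat s)) * [:2, 1:] ^ (card (pverts G) + card (pverts H)) =
    [:2, 1:] ^ (card (undirected_edges G) + card (undirected_edges H)) *
    (\<Prod>l\<in>#adjacency_spectrum G. block_factor r l) * (\<Prod>l\<in>#adjacency_spectrum H. block_factor s l) *
    char_poly (map_mat complex_of_real
      (mat_of_rows_list 4 (quotient_rows (card (pverts G)) r (card (pverts H)) s)))"
    (is "?L = ?R")
proof -
  have P: "pair_graph G" "pair_graph H" using G H by (simp_all add: regular_graph_def)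
  interpret G: pair_graph G by (fact P)
  interpret H: pair_graph H by (fact P)
  note finE = finite_undirected_edges[OF P(1)] finite_undirected_edges[OF P(2)]
  obtain vs where vs: "distinct vs" "set vs = pverts G"
    using finite_distinct_list[OF G.pair_finite_verts] by auto
  obtain es where es: "distinct es" "set es = undirected_edges G"
    using finite_distinct_list[OF finE(1)] by auto
  obtain vs' where vs': "distinct vs'" "set vs' = pverts H"
    using finite_distinct_list[OF H.pair_finite_verts] by auto
  obtain es' where es': "distinct es'" "set es' = undirected_edges H"
    using finite_distinct_list[OF finE(2)] by auto
  define ws where "ws = map Inl vs @ map Inr es"
  define ws' where "ws' = map Inl vs' @ map Inr es'"
  \<comment> \<open>This enumeration lists the four classes consecutively, which exhibits the
    blocks; similarity later transfers the result to \<open>xs\<close>.\<close>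
  define zs where "zs = map Inl ws @ map Inr ws'"
  have len: "length vs = card (pverts G)" "length es = card (undirected_edges G)"
    "length vs' = card (pverts H)" "length es' = card (undirected_edges H)"
    using vs es vs' es' by (simp_all flip: distinct_card)
  have zs: "distinct zs" "set zs = pverts J"
    using vs es vs' es'
    by (auto simp: zs_def ws_def ws'_def J_def pverts_join distinct_map inj_on_def)
  have zs_Plus: "set zs = (pverts G <+> undirected_edges G) <+> (pverts H <+> undirected_edges H)"
    using zs by (simp add: J_def pverts_join)
  have sum_zs: "sum g (set zs) =
      (\<Sum>v\<in>pverts G. g (Inl (Inl v))) + (\<Sum>e\<in>undirected_edges G. g (Inl (Inr e))) +
      ((\<Sum>v\<in>pverts H. g (Inr (Inl v))) + (\<Sum>e\<in>undirected_edges H. g (Inr (Inr e))))"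
    for g :: "('a + 'a set) + ('b + 'b set) \<Rightarrow> complex"
    unfolding zs_Plus using finE by (simp add: sum.Plus)
  have edges: "complex_of_nat (card (undirected_edges G)) = of_nat (card (pverts G)) * of_nat r / 2"
    "complex_of_nat (card (undirected_edges H)) = of_nat (card (pverts H)) * of_nat s / 2"
    using handshake[OF G(1), THEN arg_cong[of _ _ complex_of_nat]]
      handshake[OF H(1), THEN arg_cong[of _ _ complex_of_nat]]
    by (simp_all add: field_simps)
  let ?cs = "[0, 1, 2, 3 :: nat]"
  have main: "poly (char_poly (map_mat complex_of_real (vertex_mat zs (graph_distance J)))) t *
      (poly (block_factor r (of_nat r)) t * poly (block_factor s (of_nat s)) t) =
    det (indexed_mat ws ws (sub_block G t)) * det (indexed_mat ws' ws' (sub_block H t)) *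
    poly (char_poly (map_mat complex_of_real
      (mat_of_rows_list 4 (quotient_rows (card (pverts G)) r (card (pverts H)) s)))) t" for t
  proof -
    define E where "E = indexed_mat zs zs (join_block G H t)"
    define U where "U = indexed_mat zs ?cs (\<lambda>x c. of_bool (vertex_class x = c) :: complex)"
    define X where "X = indexed_mat ?cs zs (\<lambda>c x. - class_dist c (vertex_class x))"
    define K where "K = indexed_mat ?cs ?cs (block_quotient t r s)"
    have cs: "distinct ?cs" by simp
    \<comment> \<open>Each row of \<open>U\<close> contains a single 1, so multiplying by
      \<open>U\<close> on the left just selects the row of the vertex class.\<close>
    have class_sum: "(\<Sum>c\<in>set ?cs. of_bool (vertex_class x = c) * g c) = g (vertex_class x)"
      for x :: "('a + 'a set) + ('b + 'b set)" and g :: "nat \<Rightarrow> complex"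
      by (cases x rule: vertex_class.cases) auto
    have EU: "E * U = indexed_mat zs ?cs
        (\<lambda>x c. \<Sum>y\<in>set zs. join_block G H t x y * of_bool (vertex_class y = c))"
      unfolding E_def U_def by (rule indexed_mat_mult) (rule zs)
    also have "\<dots> = indexed_mat zs ?cs (\<lambda>x c. block_quotient t r s (vertex_class x) c)"
    proof (rule indexed_mat_cong)
      fix x c assume x: "x \<in> set zs" and c: "c \<in> set ?cs"
      show "(\<Sum>y\<in>set zs. join_block G H t x y * of_bool (vertex_class y = c)) =
          block_quotient t r s (vertex_class x) c"
        using x[unfolded zs_Plus] c unfolding sum_zs
        by (cases x rule: vertex_class.cases)
          (auto simp: block_quotient_def sub_block_row_sums[OF G(1)] sub_block_row_sums[OF H(1)]
            simp del: sub_block.simps)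
    qed
    also have "\<dots> = U * K"
      unfolding U_def K_def indexed_mat_mult[OF cs] class_sum ..
    finally have inv: "E * U = U * K" .
    have "U * X = indexed_mat zs zs (\<lambda>x y. - class_dist (vertex_class x) (vertex_class y))"
      unfolding U_def X_def indexed_mat_mult[OF cs] class_sum ..
    then have "E + U * X = indexed_mat zs zs
        (\<lambda>x y. join_block G H t x y - class_dist (vertex_class x) (vertex_class y))"
      by (simp add: E_def indexed_mat_add)
    also have "\<dots> = indexed_mat zs zs (\<lambda>x y. (if x = y then t else 0) -
        complex_of_real (graph_distance J x y))"
    proof (rule indexed_mat_cong)
      fix x y assume "x \<in> set zs" "y \<in> set zs"
      then have "graph_distance J x y = real (join_dist G H x y)"
        unfolding J_def zs by (intro graph_distance_join[OF G H]) (simp_all add: zs J_def)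
      then show "join_block G H t x y - class_dist (vertex_class x) (vertex_class y) =
          (if x = y then t else 0) - complex_of_real (graph_distance J x y)"
        by (cases x rule: vertex_class.cases; cases y rule: vertex_class.cases)
          (auto simp: class_dist_def G.no_loops' H.no_loops')
    qed
    finally have A: "det (E + U * X) =
        poly (char_poly (map_mat complex_of_real (vertex_mat zs (graph_distance J)))) t"
      by (simp add: poly_char_poly_vertex_mat[OF zs(1)])
    have "X * U = indexed_mat ?cs ?cs (\<lambda>a b.
        \<Sum>x\<in>set zs. - class_dist a (vertex_class x) * of_bool (vertex_class x = b))"
      unfolding X_def U_def by (rule indexed_mat_mult) (rule zs)
    then have "K + X * U = indexed_mat ?cs ?cs (\<lambda>a b. block_quotient t r s a b +
        (\<Sum>x\<in>set zs. - class_dist a (vertex_class x) * of_bool (vertex_class x = b)))"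
      by (simp add: K_def indexed_mat_add)
    also have "\<dots> = indexed_mat ?cs ?cs (\<lambda>a b. (if a = b then t else 0) -
        complex_of_real (quotient_rows (card (pverts G)) r (card (pverts H)) s ! a ! b))"
      by (rule indexed_mat_cong, unfold sum_zs)
        (auto simp: block_quotient_def class_dist_def quotient_rows_def edges)
    finally have B: "det (K + X * U) = poly (char_poly (map_mat complex_of_real
        (mat_of_rows_list 4 (quotient_rows (card (pverts G)) r (card (pverts H)) s)))) t"
      by (simp add: mat_of_quotient_rows poly_char_poly_vertex_mat)
    have "det E = det (indexed_mat ws ws (sub_block G t)) * det (indexed_mat ws' ws' (sub_block H t))"
      unfolding E_def zs_def indexed_mat_append indexed_mat_map
      by (subst det_four_block_mat_upper_right_zero[of _ "length ws" _ "length ws'"])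
        (auto simp: indexed_mat_zero)
    moreover have "det (E + U * X) * det K = det E * det (K + X * U)"
      by (rule det_perturb_invariant[OF _ _ _ _ inv, of "length zs" "length ?cs"])
        (unfold E_def U_def X_def K_def, (rule indexed_mat_carrier)+)
    moreover have "det K = poly (block_factor r (of_nat r)) t * poly (block_factor s (of_nat s)) t"
      unfolding K_def by (rule det_block_quotient)
    ultimately show ?thesis unfolding A B by simp
  qed
  have poly_prod: "poly (\<Prod>l\<in>#S. block_factor k l) t =
      (\<Prod>l\<in>#S. t\<^sup>2 + (6 + 2 * l) * t + 8 - 4 * of_nat k)" for S k t
    by (induction S) (auto simp: poly_block_factor)
  have eq: "char_poly (map_mat complex_of_real (vertex_mat xs (graph_distance J))) =
      char_poly (map_mat complex_of_real (vertex_mat zs (graph_distance J)))"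
    by (rule char_poly_similar[OF similar_vertex_mat[OF xs zs]])
  have "poly ?L t = poly ?R t" for t
  proof -
    let ?M = "poly (char_poly (map_mat complex_of_real
      (mat_of_rows_list 4 (quotient_rows (card (pverts G)) r (card (pverts H)) s)))) t"
    have shift: "poly [:2, 1:] t = t + 2" by simp
    \<comment> \<open>The powers of \<open>t + 2\<close> are shared out between the two graphs in
      the form in which \<open>det_sub_block\<close> needs them.\<close>
    have "poly ?L t = (det (indexed_mat ws ws (sub_block G t)) * (t + 2) ^ card (pverts G)) *
       (det (indexed_mat ws' ws' (sub_block H t)) * (t + 2) ^ card (pverts H)) * ?M"
      unfolding eq poly_mult poly_power main shift power_add by (simp only: mult_ac)
    also have "\<dots> = poly ?R t"
      unfolding det_sub_block[OF G(1) vs es ws_def, unfolded len]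
        det_sub_block[OF H(1) vs' es' ws'_def, unfolded len]
        poly_mult poly_power poly_prod shift power_add by (simp only: mult_ac)
    finally show ?thesis .
  qed
  then show ?thesis by (simp add: poly_eq_poly_eq_iff[symmetric] fun_eq_iff)
qed

text \<open>
  The hypothesis makes the discriminant nonnegative; for a negative one, the real \<open>sqrt\<close> would not
  produce the roots.
\<close>

lemma block_factor_split:
  assumes "\<bar>l\<bar> \<le> real r"
  shows "block_factor r (complex_of_real l) =
    [:- complex_of_real (- (l + 3 + sqrt ((l + 1)\<^sup>2 + 4 * (l + real r)))), 1:] *
    [:- complex_of_real (- (l + 3 - sqrt ((l + 1)\<^sup>2 + 4 * (l + real r)))), 1:]"
proof -
  define d where "d = sqrt ((l + 1)\<^sup>2 + 4 * (l + real r))"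
  have "d\<^sup>2 = (l + 1)\<^sup>2 + 4 * (l + real r)" unfolding d_def using assms by simp
  \<comment> \<open>Comparison of constant terms: the product is \<open>(l + 3)^2 - d^2\<close>, and
    the linear terms in \<open>l\<close> cancel.\<close>
  then have "(l + 3 + d) * (l + 3 - d) = 8 - 4 * real r" by (simp add: algebra_simps power2_eq_square)
  then have "complex_of_real (l + 3 + d) * complex_of_real (l + 3 - d) = of_real (8 - 4 * real r)"
    by (metis of_real_mult)
  then show ?thesis unfolding d_def[symmetric] block_factor_def by (simp add: algebra_simps)
qed

section \<open>From the polynomial identity to the spectrum\<close>

lemma proots_prod_block_factor:
  assumes "\<And>j. j \<in># S \<Longrightarrow> \<bar>l j\<bar> \<le> real r"
  shows "proots (\<Prod>j\<in>#S. block_factor r (complex_of_real (l j))) =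
    {# complex_of_real (- (l j + 3 + sqrt ((l j + 1)\<^sup>2 + 4 * (l j + real r)))). j \<in># S #} +
    {# complex_of_real (- (l j + 3 - sqrt ((l j + 1)\<^sup>2 + 4 * (l j + real r)))). j \<in># S #}"
  using assms
proof (induction S)
  case (add j S)
  have nz: "(\<Prod>j\<in>#S. block_factor r (complex_of_real (l j))) \<noteq> 0" by (auto simp: prod_mset_zero_iff)
  have split: "proots (block_factor r (complex_of_real (l j))) =
    {# complex_of_real (- (l j + 3 + sqrt ((l j + 1)\<^sup>2 + 4 * (l j + real r)))),
       complex_of_real (- (l j + 3 - sqrt ((l j + 1)\<^sup>2 + 4 * (l j + real r)))) #}"
    using add.prems by (subst block_factor_split) (auto simp: proots_mult simp del: mult_pCons_left mult_pCons_right)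
  have "proots (\<Prod>j\<in>#add_mset j S. block_factor r (complex_of_real (l j))) =
    proots (block_factor r (complex_of_real (l j))) +
    proots (\<Prod>j\<in>#S. block_factor r (complex_of_real (l j)))"
    using nz by (simp add: proots_mult)
  then show ?case using add by (simp only: split) simp
qed simp

theorem theorem3p17:
  fixes G\<^sub>1 :: "'a pair_pre_digraph" and G\<^sub>2 :: "'b pair_pre_digraph"
    and r\<^sub>1 r\<^sub>2 p\<^sub>1 p\<^sub>2 :: nat
    and l\<^sub>1 l\<^sub>2 :: "nat \<Rightarrow> real"
  assumes "regular_graph G\<^sub>1 r\<^sub>1" and "regular_graph G\<^sub>2 r\<^sub>2"
    and "card (pverts G\<^sub>1) = p\<^sub>1" and "card (pverts G\<^sub>2) = p\<^sub>2"
    and "adjacency_spectrum G\<^sub>1 =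
           {# complex_of_real (real r\<^sub>1) #} + {# complex_of_real (l\<^sub>1 j). j \<in># mset_set {2..p\<^sub>1} #}"
    and "adjacency_spectrum G\<^sub>2 =
           {# complex_of_real (real r\<^sub>2) #} + {# complex_of_real (l\<^sub>2 j). j \<in># mset_set {2..p\<^sub>2} #}"
    and "connected_graph (subdivision_edge_join G\<^sub>1 G\<^sub>2)"
  shows "\<forall>\<mu> :: complex.
    real (count (distance_spectrum (subdivision_edge_join G\<^sub>1 G\<^sub>2)) \<mu>) =
      real (count {# complex_of_real
        (- (l\<^sub>1 j + 3 + sqrt ((l\<^sub>1 j + 1)\<^sup>2 + 4 * (l\<^sub>1 j + real r\<^sub>1)))). j \<in># mset_set {2..p\<^sub>1} #} \<mu>)
    + real (count {# complex_of_real
        (- (l\<^sub>1 j + 3 - sqrt ((l\<^sub>1 j + 1)\<^sup>2 + 4 * (l\<^sub>1 j + real r\<^sub>1)))). j \<in># mset_set {2..p\<^sub>1} #} \<mu>)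
    + real (count {# complex_of_real
        (- (l\<^sub>2 j + 3 + sqrt ((l\<^sub>2 j + 1)\<^sup>2 + 4 * (l\<^sub>2 j + real r\<^sub>2)))). j \<in># mset_set {2..p\<^sub>2} #} \<mu>)
    + real (count {# complex_of_real
        (- (l\<^sub>2 j + 3 - sqrt ((l\<^sub>2 j + 1)\<^sup>2 + 4 * (l\<^sub>2 j + real r\<^sub>2)))). j \<in># mset_set {2..p\<^sub>2} #} \<mu>)
    + (if \<mu> = -2
       then 1/2 * real p\<^sub>1 * real r\<^sub>1 + 1/2 * real p\<^sub>2 * real r\<^sub>2 - real p\<^sub>1 - real p\<^sub>2 else 0)
    + real (count (eigenvalue_mset (mat_of_rows_list 4
       [[4 * real p\<^sub>1 - 2 * real r\<^sub>1 - 4, 3/2 * real p\<^sub>1 * real r\<^sub>1 - 2 * real r\<^sub>1,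
         3 * real p\<^sub>2, real p\<^sub>2 * real r\<^sub>2],
        [3 * real p\<^sub>1 - 4, real p\<^sub>1 * real r\<^sub>1 - 2,
         2 * real p\<^sub>2, 1/2 * real p\<^sub>2 * real r\<^sub>2],
        [3 * real p\<^sub>1, real p\<^sub>1 * real r\<^sub>1,
         4 * real p\<^sub>2 - 2 * real r\<^sub>2 - 4, 3/2 * real p\<^sub>2 * real r\<^sub>2 - 2 * real r\<^sub>2],
        [2 * real p\<^sub>1, 1/2 * real p\<^sub>1 * real r\<^sub>1,
         3 * real p\<^sub>2 - 4, real p\<^sub>2 * real r\<^sub>2 - 2]])) \<mu>)"
proof -
  let ?J = "subdivision_edge_join G\<^sub>1 G\<^sub>2"
  have P: "pair_graph G\<^sub>1" "pair_graph G\<^sub>2" using assms(1,2) by (simp_all add: regular_graph_def)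
  interpret J: pair_graph ?J by (rule pair_graph_subdivision_edge_join[OF P])
  \<comment> \<open>The listed eigenvalue \<open>r\<close> makes each spectrum, and hence each
    vertex set, nonempty.\<close>
  have ne: "pverts G\<^sub>1 \<noteq> {}" "pverts G\<^sub>2 \<noteq> {}"
    using size_adjacency_spectrum[OF P(1)] size_adjacency_spectrum[OF P(2)]
    by (auto simp: assms(5,6))
  note pos = join_positive_degrees[OF assms(1) ne(1) assms(2) ne(2) assms(7)]
  obtain xs where xs: "distinct xs" "set xs = pverts ?J"
    using finite_distinct_list[OF J.pair_finite_verts] by auto
  define P0 where "P0 = char_poly (map_mat complex_of_real (vertex_mat xs (graph_distance ?J)))"
  define M0 where "M0 = char_poly (map_mat complex_of_real
      (mat_of_rows_list 4 (quotient_rows p\<^sub>1 r\<^sub>1 p\<^sub>2 r\<^sub>2)))"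
  define S1 where "S1 = (\<Prod>j\<in>#mset_set {2..p\<^sub>1}. block_factor r\<^sub>1 (complex_of_real (l\<^sub>1 j)))"
  define S2 where "S2 = (\<Prod>j\<in>#mset_set {2..p\<^sub>2}. block_factor r\<^sub>2 (complex_of_real (l\<^sub>2 j)))"
  define m1 where "m1 = card (undirected_edges G\<^sub>1)"
  define m2 where "m2 = card (undirected_edges G\<^sub>2)"
  have nz: "P0 \<noteq> 0" "M0 \<noteq> 0" "S1 \<noteq> 0" "S2 \<noteq> 0"
    by (auto simp: P0_def M0_def mat_of_quotient_rows char_poly_vertex_mat_nonzero
        S1_def S2_def prod_mset_zero_iff)
  have "P0 * (block_factor r\<^sub>1 (of_nat r\<^sub>1) * block_factor r\<^sub>2 (of_nat r\<^sub>2)) * [:2, 1:] ^ (p\<^sub>1 + p\<^sub>2) =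
    [:2, 1:] ^ (m1 + m2) * (block_factor r\<^sub>1 (of_nat r\<^sub>1) * S1) * (block_factor r\<^sub>2 (of_nat r\<^sub>2) * S2) * M0"
    using char_poly_distance_join[OF assms(1) pos(1) ne(1) assms(2) pos(2) ne(2) xs]
    by (simp add: assms(3-6) P0_def M0_def S1_def S2_def m1_def m2_def
        image_mset.compositionality o_def)
  \<comment> \<open>The factors of the eigenvalues \<open>r\<^sub>1\<close> and
    \<open>r\<^sub>2\<close> are nonzero polynomials and cancel.\<close>
  then have "P0 * [:2, 1:] ^ (p\<^sub>1 + p\<^sub>2) = [:2, 1:] ^ (m1 + m2) * S1 * S2 * M0"
    by (simp add: mult_ac)
  then have "proots (P0 * [:2, 1:] ^ (p\<^sub>1 + p\<^sub>2)) = proots ([:2, 1:] ^ (m1 + m2) * S1 * S2 * M0)"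
    by simp
  then have "proots P0 + repeat_mset (p\<^sub>1 + p\<^sub>2) {#-2#} =
      repeat_mset (m1 + m2) {#-2#} + proots S1 + proots S2 + proots M0"
    using nz by (simp add: proots_mult proots_power)
  then have cnt_nat: "count (proots P0) \<mu> + (p\<^sub>1 + p\<^sub>2) * (if \<mu> = -2 then 1 else 0) =
      (m1 + m2) * (if \<mu> = -2 then 1 else 0) + count (proots S1) \<mu> + count (proots S2) \<mu> + count (proots M0) \<mu>" for \<mu>
    by (auto simp: multiset_eq_iff dest!: spec[of _ \<mu>])
  \<comment> \<open>The count is subtracted only in the reals: when both degrees are 1,
    \<open>m1 + m2 < p\<^sub>1 + p\<^sub>2\<close>, so the contribution at -2 is negative and is
    compensated by the other terms.\<close>
  have cnt: "real (count (proots P0) \<mu>) =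
      (if \<mu> = -2 then real m1 + real m2 - real p\<^sub>1 - real p\<^sub>2 else 0) +
      real (count (proots S1) \<mu>) + real (count (proots S2) \<mu>) + real (count (proots M0) \<mu>)" for \<mu>
    using cnt_nat[of \<mu>] by (auto split: if_splits)
  have bound1: "\<bar>l\<^sub>1 j\<bar> \<le> real r\<^sub>1" if "j \<in># mset_set {2..p\<^sub>1}" for j
    using adjacency_spectrum_bound[OF assms(1), of "complex_of_real (l\<^sub>1 j)"] that
    by (auto simp: assms(5))
  have bound2: "\<bar>l\<^sub>2 j\<bar> \<le> real r\<^sub>2" if "j \<in># mset_set {2..p\<^sub>2}" for j
    using adjacency_spectrum_bound[OF assms(2), of "complex_of_real (l\<^sub>2 j)"] that
    by (auto simp: assms(6))
  have m: "real m1 = 1/2 * real p\<^sub>1 * real r\<^sub>1" "real m2 = 1/2 * real p\<^sub>2 * real r\<^sub>2"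
    using handshake[OF assms(1), THEN arg_cong[of _ _ real]]
      handshake[OF assms(2), THEN arg_cong[of _ _ real]]
    by (simp_all add: m1_def m2_def assms(3,4))
  have P0: "distance_spectrum ?J = proots P0"
    by (simp add: distance_spectrum_def indexed_eigenvalues_eq[OF xs] eigenvalue_mset_def P0_def)
  have M0: "proots M0 = eigenvalue_mset (mat_of_rows_list 4 (quotient_rows p\<^sub>1 r\<^sub>1 p\<^sub>2 r\<^sub>2))"
    by (simp add: M0_def eigenvalue_mset_def)
  have S: "proots S1 =
      {# complex_of_real (- (l\<^sub>1 j + 3 + sqrt ((l\<^sub>1 j + 1)\<^sup>2 + 4 * (l\<^sub>1 j + real r\<^sub>1)))). j \<in># mset_set {2..p\<^sub>1} #} +
      {# complex_of_real (- (l\<^sub>1 j + 3 - sqrt ((l\<^sub>1 j + 1)\<^sup>2 + 4 * (l\<^sub>1 j + real r\<^sub>1)))). j \<in># mset_set {2..p\<^sub>1} #}"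
    "proots S2 =
      {# complex_of_real (- (l\<^sub>2 j + 3 + sqrt ((l\<^sub>2 j + 1)\<^sup>2 + 4 * (l\<^sub>2 j + real r\<^sub>2)))). j \<in># mset_set {2..p\<^sub>2} #} +
      {# complex_of_real (- (l\<^sub>2 j + 3 - sqrt ((l\<^sub>2 j + 1)\<^sup>2 + 4 * (l\<^sub>2 j + real r\<^sub>2)))). j \<in># mset_set {2..p\<^sub>2} #}"
    unfolding S1_def S2_def by (intro proots_prod_block_factor bound1 bound2; assumption)+
  show ?thesis
    unfolding P0 cnt S M0 m quotient_rows_def count_union of_nat_add by simp
qed

end
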